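(* Let $K$ be a number field of degree $\geq 3$. Then $K$ has infinitely many orders that are rationally monogenic but not monogenic.
   Context: An order of a number field $K$ is a subring of $K$ that is free of rank $[K:\mathbb{Q}]$ as a $\mathbb{Z}$-module. An order $\mathcal{O}$ of $K$ is called monogenic if $\mathcal{O}=\mathbb{Z}[\alpha]$ for some $\alpha\in\mathcal{O}$. For an algebraic number $\alpha$ of degree $n$ over $\mathbb{Q}$, let $\mathcal{M}_{\alpha}:=\{x_0+x_1\alpha+\cdots+x_{n-1}\alpha^{n-1}:\ x_0,\ldots,x_{n-1}\in\mathbb{Z}\}$ and $\mathbb{Z}_{\alpha}:=\{\xi\in\mathbb{Q}(\alpha):\ \xi\mathcal{M}_{\alpha}\subseteq\mathcal{M}_{\alpha}\}$. An order $\mathcal{O}$ of $K$ is called rationally monogenic if $\mathcal{O}=\mathbb{Z}_{\alpha}$ for some $\alpha$ with $K=\mathbb{Q}(\alpha)$. *)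

theory Defs
  imports Complex_Main
begin

text \<open>
  All number fields, subfields and orders are subsets of an ambient field of characteristic 0,
  given by a type of class \<^class>\<open>field_char_0\<close>. Rings have a unit and subrings contain it.
\<close>

definition is_subring :: "'a::comm_ring_1 set \<Rightarrow> bool" where
  "is_subring R \<longleftrightarrow> 1 \<in> R \<and> (\<forall>x\<in>R. \<forall>y\<in>R. x - y \<in> R \<and> x * y \<in> R)"

definition is_subfield :: "'a::field set \<Rightarrow> bool" where
  "is_subfield F \<longleftrightarrow> is_subring F \<and> (\<forall>x\<in>F. x \<noteq> 0 \<longrightarrow> inverse x \<in> F)"

text \<open>The ambient field as a rational vector space and as an abelian group.\<close>

interpretation rat_vs: vector_space "\<lambda>(q::rat) (x::'a::field_char_0). of_rat q * x"
  by unfold_locales (simp_all add: algebra_simps of_rat_add of_rat_mult)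

interpretation int_mod: module "\<lambda>(k::int) (x::'a::field_char_0). of_int k * x"
  by unfold_locales (simp_all add: algebra_simps)

definition number_field :: "'a::field_char_0 set \<Rightarrow> bool" where
  "number_field K \<longleftrightarrow> is_subfield K \<and> (\<exists>B. finite B \<and> rat_vs.span B = K)"

text \<open>Junk value 0 if \<open>K\<close> has infinite dimension over the rationals.\<close>

definition field_degree :: "'a::field_char_0 set \<Rightarrow> nat" where
  "field_degree K = rat_vs.dim K"

definition adjoin_Q :: "'a::field_char_0 \<Rightarrow> 'a set" where
  "adjoin_Q \<alpha> = is_subfield hull {\<alpha>}"

definition adjoin_Z :: "'a::field_char_0 \<Rightarrow> 'a set" where
  "adjoin_Z \<alpha> = is_subring hull {\<alpha>}"

definition is_order :: "'a::field_char_0 set \<Rightarrow> 'a set \<Rightarrow> bool" where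
  "is_order K R \<longleftrightarrow> is_subring R \<and> R \<subseteq> K \<and>
     (\<exists>B. finite B \<and> card B = field_degree K \<and> int_mod.independent B \<and> int_mod.span B = R)"

definition monogenic_order :: "'a::field_char_0 set \<Rightarrow> 'a set \<Rightarrow> bool" where
  "monogenic_order K R \<longleftrightarrow> is_order K R \<and> (\<exists>\<alpha>\<in>R. R = adjoin_Z \<alpha>)"

definition M_module :: "'a::field_char_0 \<Rightarrow> 'a set" where
  "M_module \<alpha> = {\<Sum>i<field_degree (adjoin_Q \<alpha>). of_int (x i) * \<alpha> ^ i | x :: nat \<Rightarrow> int. True}"

definition Z_ring :: "'a::field_char_0 \<Rightarrow> 'a set" where
  "Z_ring \<alpha> = {\<xi> \<in> adjoin_Q \<alpha>. \<forall>\<mu>\<in>M_module \<alpha>. \<xi> * \<mu> \<in> M_module \<alpha>}"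

definition rationally_monogenic_order :: "'a::field_char_0 set \<Rightarrow> 'a set \<Rightarrow> bool" where
  "rationally_monogenic_order K R \<longleftrightarrow> is_order K R \<and> (\<exists>\<alpha>. K = adjoin_Q \<alpha> \<and> R = Z_ring \<alpha>)"

end

theory Submission
  imports Defs "Jordan_Normal_Form.Char_Poly" "HOL-Number_Theory.Number_Theory"
    "HOL-Computational_Algebra.Fundamental_Theorem_Algebra"
begin

text \<open>
  Let \<open>n = [K : \<rat>]\<close>. If \<open>\<alpha>\<close> generates \<open>K\<close> and is a root of the primitive polynomial
  \<open>f = a X\<^sup>n + \<dots>\<close>, and \<open>q\<close> is coprime to \<open>a\<close>, then \<open>\<int>\<^bsub>q\<alpha>\<^esub>\<close> has a basis \<open>q\<^sup>i \<omega>\<^sub>i\<close> (\<open>i < n\<close>)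
  with \<open>\<omega>\<^sub>0 = 1\<close> and \<open>\<omega>\<^sub>i = a \<alpha>\<^sup>i + \<dots>\<close>.
  Let \<open>p\<close> be a prime divisor of \<open>q\<close>. Modulo \<open>p\<close> the powers of an element \<open>\<Sum> x\<^sub>i q\<^sup>i \<omega>\<^sub>i\<close> with \<open>x\<^sub>0 = 0\<close>
  have a triangular coordinate matrix with diagonal entries \<open>x\<^sub>1\<^sup>i a\<^bsup>i-1\<^esup>\<close>. If the order is
  monogenic, this matrix can be taken to have determinant \<open>\<plusminus>1\<close>, so
  \<open>x\<^bsup>n(n-1)\<^esup> a\<^bsup>(n-1)(n-2)\<^esup> \<equiv> 1 (mod p)\<close> for some \<open>x\<close>. This is impossible if \<open>p \<equiv> 1 (mod n)\<close>, \<open>n \<ge> 3\<close> and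
  \<open>a\<close> is a primitive root modulo \<open>p\<close>; the powers \<open>q = p\<^sup>k\<close> then give infinitely many orders.

  To find \<open>\<alpha>\<close>, let \<open>g\<close> be an irreducible polynomial with root \<open>\<theta>\<close> generating \<open>K\<close>. A prime
  \<open>p \<equiv> 1 (mod n)\<close> modulo which \<open>g\<close> has a simple root is obtained as a prime divisor of a value of
  the minimal polynomial of a primitive element of \<open>\<rat>(\<theta>, \<zeta>\<^sub>n)\<close>. The root can be lifted to \<open>a\<^sub>0\<close> such that
  \<open>g(a\<^sub>0) = p c\<close> with \<open>c\<close> in any prescribed residue class modulo \<open>p\<close>, and \<open>c\<close> is the leading coefficient
  of the primitive polynomial of \<open>p / (\<theta> - a\<^sub>0)\<close>.
\<close>

section \<open>Values of polynomials and subrings\<close>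

hide_const (open) Module.smult UnivPoly.monom UnivPoly.coeff

definition rat_eval :: "rat poly \<Rightarrow> 'a::field_char_0 \<Rightarrow> 'a" where
  "rat_eval P x = poly (map_poly of_rat P) x"

definition int_eval :: "int poly \<Rightarrow> 'a::comm_ring_1 \<Rightarrow> 'a" where
  "int_eval P x = poly (of_int_poly P) x"

lemma rat_eval_simps [simp]:
  fixes x :: "'a::field_char_0"
  shows
  "rat_eval 0 x = 0" "rat_eval 1 x = 1" "rat_eval [:q:] x = of_rat q"
  "rat_eval (P + Q) x = rat_eval P x + rat_eval Q x"
  "rat_eval (P - Q) x = rat_eval P x - rat_eval Q x"
  "rat_eval (- P) x = - rat_eval P x"
  "rat_eval (P * Q) x = rat_eval P x * rat_eval Q x"
  "rat_eval (P ^ k) x = rat_eval P x ^ k"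
  "rat_eval (smult q P) x = of_rat q * rat_eval P x"
  "rat_eval (pCons q P) x = of_rat q + x * rat_eval P x"
  "rat_eval (monom q k) x = of_rat q * x ^ k"
  "rat_eval (sum F I) x = (\<Sum>i\<in>I. rat_eval (F i) x)"
proof -
  interpret of_rat: map_poly_comm_ring_hom "of_rat :: rat \<Rightarrow> 'a" ..
  show
    "rat_eval 0 x = 0" "rat_eval 1 x = 1" "rat_eval [:q:] x = of_rat q"
    "rat_eval (P + Q) x = rat_eval P x + rat_eval Q x"
    "rat_eval (P - Q) x = rat_eval P x - rat_eval Q x"
    "rat_eval (- P) x = - rat_eval P x"
    "rat_eval (P * Q) x = rat_eval P x * rat_eval Q x"
    "rat_eval (P ^ k) x = rat_eval P x ^ k"
    "rat_eval (smult q P) x = of_rat q * rat_eval P x"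
    "rat_eval (pCons q P) x = of_rat q + x * rat_eval P x"
    "rat_eval (monom q k) x = of_rat q * x ^ k"
    "rat_eval (sum F I) x = (\<Sum>i\<in>I. rat_eval (F i) x)"
    by (simp_all add: rat_eval_def hom_distribs poly_monom poly_sum)
qed

lemma rat_eval_pcompose: "rat_eval (pcompose P Q) x = rat_eval P (rat_eval Q x)"
  by (induction P) (simp_all add: pcompose_pCons)

lemma rat_eval_altdef: "degree P \<le> m \<Longrightarrow> rat_eval P x = (\<Sum>i\<le>m. of_rat (coeff P i) * x ^ i)"
  by (subst poly_as_sum_of_monoms'[of P m, symmetric]) (simp_all)

lemma int_eval_simps [simp]:
  "int_eval 0 x = 0" "int_eval 1 x = 1" "int_eval [:k:] x = of_int k"
  "int_eval (P + Q) x = int_eval P x + int_eval Q x"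
  "int_eval (P - Q) x = int_eval P x - int_eval Q x"
  "int_eval (- P) x = - int_eval P x"
  "int_eval (P * Q) x = int_eval P x * int_eval Q x"
  "int_eval (P ^ m) x = int_eval P x ^ m"
  "int_eval (smult k P) x = of_int k * int_eval P x"
  "int_eval (pCons k P) x = of_int k + x * int_eval P x"
  "int_eval (monom k m) x = of_int k * x ^ m"
  "int_eval (sum F I) x = (\<Sum>i\<in>I. int_eval (F i) x)"
  by (simp_all add: int_eval_def hom_distribs poly_monom poly_sum)

lemma int_eval_pcompose: "int_eval (pcompose P Q) x = int_eval P (int_eval Q x)"
  by (induction P) (simp_all add: pcompose_pCons)

lemma int_eval_altdef: "degree P \<le> m \<Longrightarrow> int_eval P x = (\<Sum>i\<le>m. of_int (coeff P i) * x ^ i)"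
  by (subst poly_as_sum_of_monoms'[of P m, symmetric]) (simp_all)

lemma rat_eval_of_int_poly: "rat_eval (of_int_poly P) x = int_eval P x"
  by (induction P) (simp_all)

lemma clear_denominators:
  fixes P :: "rat poly"
  obtains D :: int and Q :: "int poly" where "D > 0" "of_int_poly Q = smult (of_int D) P"
proof -
  have "\<exists>(D::int) (Q::int poly). D > 0 \<and> of_int_poly Q = smult (of_int D) P"
  proof (induction P)
    case 0
    then show ?case by (intro exI[of _ 1] exI[of _ 0]) simp
  next
    case (pCons a P)
    then obtain D and Q :: "int poly" where DQ: "D > 0" "of_int_poly Q = smult (of_int D) P" by blast
    obtain u v where uv: "quotient_of a = (u, v)" by fastforce
    then have v: "v > 0" "a = of_int u / of_int v"
      using quotient_of_denom_pos quotient_of_div by auto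
    show ?case
      by (rule exI[of _ "v * D"], rule exI[of _ "pCons (D * u) (smult v Q)"])
        (use DQ v in \<open>simp add: hom_distribs\<close>)
  qed
  then show ?thesis using that by blast
qed

lemma subring_closed:
  assumes "is_subring R"
  shows "0 \<in> R" "1 \<in> R" "x \<in> R \<Longrightarrow> y \<in> R \<Longrightarrow> x * y \<in> R" "x \<in> R \<Longrightarrow> y \<in> R \<Longrightarrow> x - y \<in> R"
    "x \<in> R \<Longrightarrow> - x \<in> R" "x \<in> R \<Longrightarrow> y \<in> R \<Longrightarrow> x + y \<in> R"
proof -
  show 0: "0 \<in> R" using assms unfolding is_subring_def by (metis diff_self)
  show "1 \<in> R" "x \<in> R \<Longrightarrow> y \<in> R \<Longrightarrow> x * y \<in> R" "x \<in> R \<Longrightarrow> y \<in> R \<Longrightarrow> x - y \<in> R"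
    using assms by (auto simp: is_subring_def)
  have neg: "- x \<in> R" if "x \<in> R" for x
    using assms 0 that unfolding is_subring_def by (metis diff_0)
  then show "x \<in> R \<Longrightarrow> - x \<in> R" .
  show "x + y \<in> R" if "x \<in> R" "y \<in> R"
    using assms that neg[of y] unfolding is_subring_def by (metis diff_minus_eq_add)
qed

lemma subring_of_nat: "is_subring R \<Longrightarrow> of_nat k \<in> R"
  by (induction k) (auto intro: subring_closed)

lemma subring_of_int: "is_subring R \<Longrightarrow> of_int k \<in> R"
  by (cases k) (auto intro: subring_closed subring_of_nat simp: subring_closed)

lemma subring_sum: "is_subring R \<Longrightarrow> (\<And>i. i \<in> I \<Longrightarrow> F i \<in> R) \<Longrightarrow> sum F I \<in> R"
  by (induction I rule: infinite_finite_induct) (auto intro: subring_closed)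

lemma subring_power: "is_subring R \<Longrightarrow> x \<in> R \<Longrightarrow> x ^ k \<in> R"
  by (induction k) (auto intro: subring_closed)

lemma subring_int_eval: "is_subring R \<Longrightarrow> x \<in> R \<Longrightarrow> int_eval P x \<in> R"
  by (induction P) (auto intro: subring_closed subring_of_int)

lemma subfield_is_subring: "is_subfield K \<Longrightarrow> is_subring K"
  by (simp add: is_subfield_def)

lemma subfield_divide: "is_subfield K \<Longrightarrow> x \<in> K \<Longrightarrow> y \<in> K \<Longrightarrow> x / y \<in> K"
  unfolding is_subfield_def
  by (metis divide_inverse inverse_zero subring_closed(3))

lemma subfield_of_rat: "is_subfield K \<Longrightarrow> of_rat q \<in> K"
  by (cases q) (auto simp: of_rat_rat intro!: subfield_divide subring_of_int subfield_is_subring)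

lemma subfield_rat_eval: "is_subfield K \<Longrightarrow> x \<in> K \<Longrightarrow> rat_eval P x \<in> K"
  by (induction P) (auto intro!: subring_closed subfield_of_rat intro: subfield_is_subring)

section \<open>Linear relations and the ring \<open>Q[x]\<close> generated by one element\<close>

lemma (in vector_space) ex_nontrivial_relation:
  assumes "finite I" "finite B" "card B < card I" "\<And>i. i \<in> I \<Longrightarrow> v i \<in> span B"
  obtains c where "(\<Sum>i\<in>I. scale (c i) (v i)) = 0" "\<exists>i\<in>I. c i \<noteq> 0"
proof (cases "inj_on v I")
  case True
  have "dependent (v ` I)"
    using independent_span_bound[of B "v ` I"] assms card_image[OF True] by auto
  then obtain u where u: "(\<Sum>w\<in>v ` I. scale (u w) w) = 0" "\<exists>w\<in>v ` I. u w \<noteq> 0"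
    using dependent_finite[of "v ` I"] assms(1) by auto
  show ?thesis
    by (rule that[of "u \<circ> v"]) (use u in \<open>auto simp: sum.reindex[OF True]\<close>)
next
  case False
  then obtain i j where ij: "i \<in> I" "j \<in> I" "i \<noteq> j" "v i = v j" by (auto simp: inj_on_def)
  show ?thesis
  proof (rule that[of "\<lambda>k. if k = i then 1 else if k = j then - 1 else 0"])
    have "(\<Sum>k\<in>I. scale (if k = i then 1 else if k = j then - 1 else 0) (v k)) =
        (\<Sum>k\<in>{i, j}. scale (if k = i then 1 else if k = j then - 1 else 0) (v k))"
      using ij assms(1) by (intro sum.mono_neutral_right) auto
    then show "(\<Sum>k\<in>I. scale (if k = i then 1 else if k = j then - 1 else 0) (v k)) = 0"
      using ij by simp
  qed (use ij in auto)
qed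

text \<open>This is \<open>Q[x]\<close>, whose elements are explicit polynomial values; for
  algebraic \<open>x\<close> it is already a field and coincides with
  \<open>adjoin_Q x\<close>.\<close>

definition Qring :: "'a::field_char_0 \<Rightarrow> 'a set" where
  "Qring x = range (\<lambda>P. rat_eval P x)"

lemma Qring_I: "rat_eval P x \<in> Qring x"
  by (simp add: Qring_def)

lemma is_subring_Qring: "is_subring (Qring x)"
proof -
  have "rat_eval P x - rat_eval Q x \<in> Qring x" "rat_eval P x * rat_eval Q x \<in> Qring x" for P Q
    using Qring_I[of "P - Q" x] Qring_I[of "P * Q" x] by simp_all
  then show ?thesis
    using Qring_I[of 1 x] by (auto simp: is_subring_def Qring_def)
qed

lemma Qring_self: "x \<in> Qring x"
  using Qring_I[of "[:0, 1:]" x] by simp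

lemma Qring_of_rat: "of_rat q \<in> Qring x"
  using Qring_I[of "[:q:]" x] by simp

lemma Qring_mono: "y \<in> Qring x \<Longrightarrow> Qring y \<subseteq> Qring x"
  unfolding Qring_def by (auto simp: rat_eval_pcompose[symmetric])

lemma subspace_Qring: "rat_vs.subspace (Qring x)"
  by (auto simp: rat_vs.subspace_def intro!: subring_closed[OF is_subring_Qring] Qring_of_rat)

text \<open>The \<open>card B + 1\<close> powers up to \<open>x ^ card B\<close> are linearly
  dependent. The degree bound later forces a relation of degree exactly
  \<open>[Q(x) : Q]\<close>.\<close>

lemma algebraic_if_powers_in_span:
  fixes x :: "'a::field_char_0"
  assumes "finite B" "\<And>i. x ^ i \<in> rat_vs.span B"
  obtains P where "P \<noteq> 0" "degree P \<le> card B" "rat_eval P x = 0"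
proof -
  obtain c where c: "(\<Sum>i\<le>card B. of_rat (c i) * x ^ i) = 0" "\<exists>i\<in>{..card B}. c i \<noteq> 0"
    using rat_vs.ex_nontrivial_relation[of "{..card B}" B "\<lambda>i. x ^ i"] assms by auto
  let ?P = "\<Sum>i\<le>card B. monom (c i) i"
  have coeff: "coeff ?P i = (if i \<le> card B then c i else 0)" for i
    by (simp add: coeff_sum)
  show ?thesis
  proof (rule that[of ?P])
    show "?P \<noteq> 0" using c(2) coeff by (metis atMost_iff coeff_0)
    show "degree ?P \<le> card B" by (rule degree_le) (use coeff in auto)
  qed (use c(1) in simp)
qed

text \<open>A relation \<open>a + x * P(x) = 0\<close> with \<open>a \<noteq> 0\<close> exhibits the
  inverse; if \<open>a = 0\<close>, a factor \<open>x\<close> is cancelled.\<close>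

lemma inverse_in_Qring:
  assumes "P \<noteq> 0" "rat_eval P x = 0" "x \<noteq> 0"
  shows "inverse x \<in> Qring x"
  using assms
proof (induction P)
  case (pCons a P)
  show ?case
  proof (cases "a = 0")
    case False
    have "x * rat_eval P x = - of_rat a"
      using pCons.prems by (simp add: add_eq_0_iff)
    moreover have "of_rat (- inverse a) * - of_rat a = (1 :: 'a)"
      using False by (simp flip: of_rat_mult of_rat_minus)
    ultimately have "x * rat_eval (smult (- inverse a) P) x = 1"
      by (simp add: mult.left_commute[of x])
    then have "inverse x = rat_eval (smult (- inverse a) P) x"
      by (rule inverse_unique)
    then show ?thesis by (metis Qring_I)
  qed (use pCons in auto)
qed simp

lemma is_subfield_Qring:
  assumes "finite B" "Qring x \<subseteq> rat_vs.span B"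
  shows "is_subfield (Qring x)"
proof -
  have "inverse y \<in> Qring x" if y: "y \<in> Qring x" "y \<noteq> 0" for y
  proof -
    have "y ^ i \<in> rat_vs.span B" for i
      using assms(2) subring_power[OF is_subring_Qring y(1)] by blast
    then obtain P where "P \<noteq> 0" "rat_eval P y = 0"
      using algebraic_if_powers_in_span assms(1) by metis
    then show ?thesis
      using inverse_in_Qring y Qring_mono by blast
  qed
  then show ?thesis by (simp add: is_subfield_def is_subring_Qring)
qed

section \<open>Primitive elements\<close>

lemma smult_rat_vector_space: "vector_space (\<lambda>q (p :: 'a::field_char_0 poly). smult (of_rat q) p)"
  by unfold_locales (simp_all add: smult_add_right smult_add_left of_rat_add of_rat_mult)

lemma span_monom:
  fixes c :: "'a::field_char_0"
  assumes "finite B" "c \<in> rat_vs.span B" "l \<le> m"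
  shows "monom c l \<in> module.span (\<lambda>q p. smult (of_rat q) p) ((\<lambda>(b, l). monom b l) ` (B \<times> {..m}))"
proof -
  interpret pv: vector_space "\<lambda>q (p :: 'a poly). smult (of_rat q) p"
    by (rule smult_rat_vector_space)
  obtain u where u: "c = (\<Sum>b\<in>B. of_rat (u b) * b)"
    using assms(1,2) by (auto simp: rat_vs.span_finite)
  have "monom c l = (\<Sum>b\<in>B. smult (of_rat (u b)) (monom b l))"
    unfolding u by (simp add: monom_sum smult_monom)
  also have "\<dots> \<in> pv.span ((\<lambda>(b, l). monom b l) ` (B \<times> {..m}))"
    using assms(3) by (intro pv.span_sum pv.span_scale pv.span_base) auto
  finally show ?thesis .
qed

lemma span_poly:
  fixes p :: "'a::field_char_0 poly"
  assumes "finite B" "\<And>l. coeff p l \<in> rat_vs.span B" "degree p \<le> m"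
  shows "p \<in> module.span (\<lambda>q p. smult (of_rat q) p) ((\<lambda>(b, l). monom b l) ` (B \<times> {..m}))"
proof -
  interpret pv: vector_space "\<lambda>q (p :: 'a poly). smult (of_rat q) p"
    by (rule smult_rat_vector_space)
  have "p = (\<Sum>l\<le>m. monom (coeff p l) l)"
    using assms(3) by (simp add: poly_as_sum_of_monoms')
  also have "\<dots> \<in> pv.span ((\<lambda>(b, l). monom b l) ` (B \<times> {..m}))"
    using assms by (intro pv.span_sum span_monom) auto
  finally show ?thesis .
qed

text \<open>The inner variable of \<open>\<Psi>\<close> is \<open>t\<close> and stays the variable
  of the result; the outer variable \<open>X\<close> is replaced by \<open>q\<close>.\<close>

definition biv_eval :: "rat poly poly \<Rightarrow> 'a::field_char_0 poly \<Rightarrow> 'a poly" where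
  "biv_eval \<Psi> q = poly (map_poly (map_poly of_rat) \<Psi>) q"

lemma biv_eval_simps [simp]:
  fixes q :: "'a::field_char_0 poly"
  shows "biv_eval 0 q = 0"
    "biv_eval (pCons a \<Psi>) q = map_poly of_rat a + q * biv_eval \<Psi> q"
    "biv_eval (monom a k) q = map_poly of_rat a * q ^ k"
    "biv_eval (sum F I) q = (\<Sum>i\<in>I. biv_eval (F i) q)"
proof -
  interpret of_rat: map_poly_comm_ring_hom "of_rat :: rat \<Rightarrow> 'a" ..
  interpret of_rat2: map_poly_comm_ring_hom "map_poly of_rat :: rat poly \<Rightarrow> 'a poly" ..
  show "biv_eval 0 q = 0"
    "biv_eval (pCons a \<Psi>) q = map_poly of_rat a + q * biv_eval \<Psi> q"
    "biv_eval (monom a k) q = map_poly of_rat a * q ^ k"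
    "biv_eval (sum F I) q = (\<Sum>i\<in>I. biv_eval (F i) q)"
    by (simp_all add: biv_eval_def hom_distribs poly_monom poly_sum)
qed

lemma pderiv_map_of_rat:
  "pderiv (map_poly of_rat a :: 'a::field_char_0 poly) = map_poly of_rat (pderiv a)"
proof -
  interpret of_rat: map_poly_comm_ring_hom "of_rat :: rat \<Rightarrow> 'a" ..
  show ?thesis by (induction a) (simp_all add: pderiv_pCons hom_distribs)
qed

text \<open>Chain rule: \<open>map_poly pderiv\<close> is the derivative in \<open>t\<close>,
  \<open>pderiv\<close> the one in \<open>X\<close>.\<close>

lemma pderiv_biv_eval:
  "pderiv (biv_eval \<Psi> q) = biv_eval (map_poly pderiv \<Psi>) q + biv_eval (pderiv \<Psi>) q * pderiv q"
proof (induction \<Psi>)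
  case (pCons a \<Psi>)
  have add: "biv_eval (\<Phi> + \<Psi>) q = biv_eval \<Phi> q + biv_eval \<Psi> q" for \<Phi> \<Psi>
    using biv_eval_simps(4)[of "\<lambda>b. if b then \<Phi> else \<Psi>" UNIV q] by (simp add: UNIV_bool add.commute)
  have "map_poly pderiv (pCons a \<Psi>) = pCons (pderiv a) (map_poly pderiv \<Psi>)"
    using pCons.hyps by (cases "\<Psi> = 0") (simp_all add: map_poly_pCons)
  then show ?case using pCons.IH
    by (simp add: add pderiv_add pderiv_mult pderiv_map_of_rat pderiv_pCons algebra_simps)
qed simp

lemma poly_biv_eval:
  "poly (biv_eval \<Psi> q) (of_nat k) = rat_eval (map_poly (\<lambda>a. poly a (of_nat k)) \<Psi>) (poly q (of_nat k))"
proof (induction \<Psi>)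
  case (pCons a \<Psi>)
  have "map_poly (\<lambda>a. poly a (of_nat k)) (pCons a \<Psi>) =
      pCons (poly a (of_nat k)) (map_poly (\<lambda>a. poly a (of_nat k)) \<Psi>)"
    using pCons.hyps by (cases "\<Psi> = 0") (simp_all add: map_poly_pCons)
  moreover have "poly (map_poly of_rat a) (of_nat k :: 'a) = of_rat (poly a (of_nat k))"
    using of_rat_hom.poly_map_poly[of a "of_nat k"] by simp
  ultimately show ?case using pCons.IH by simp
qed simp

text \<open>Here \<open>[:x, y:]\<close> stands for \<open>x + t y\<close>. The monomial factor
  \<open>x ^ a * y ^ b\<close> strengthens the induction, since each further factor contributes one
  \<open>x\<close> or one \<open>y\<close>.\<close>

lemma coeff_linear_power_in_span:
  fixes x y :: "'a::field_char_0"
  assumes "\<And>i j. x ^ i * y ^ j \<in> rat_vs.span B"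
  shows "x ^ a * y ^ b * coeff ([:x, y:] ^ i) l \<in> rat_vs.span B"
proof (induction i arbitrary: a b l)
  case 0
  show ?case using assms by (cases l) (auto simp: rat_vs.span_zero)
next
  case (Suc i)
  have "x ^ a * y ^ b * coeff ([:x, y:] ^ Suc i) l =
      x ^ Suc a * y ^ b * coeff ([:x, y:] ^ i) l +
      (case l of 0 \<Rightarrow> 0 | Suc l' \<Rightarrow> x ^ a * y ^ Suc b * coeff ([:x, y:] ^ i) l')"
    by (cases l) (simp_all add: algebra_simps)
  also have "\<dots> \<in> rat_vs.span B"
    using Suc by (cases l) (auto intro!: rat_vs.span_add simp: rat_vs.span_zero simp del: power_Suc)
  finally show ?case .
qed

text \<open>Dimension count: the \<open>(N + 1)^2\<close> products \<open>t^j (x + t y)^i\<close>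
  have degree at most \<open>2 N\<close> and coefficients in \<open>span B\<close>, so they lie in a
  space of dimension at most \<open>card B * (2 N + 1)\<close>.\<close>

lemma ex_biv_eval_eq_0:
  fixes x y :: "'a::field_char_0"
  assumes "finite B" "\<And>i j. x ^ i * y ^ j \<in> rat_vs.span B"
  shows "\<exists>\<Psi>. \<Psi> \<noteq> 0 \<and> biv_eval \<Psi> [:x, y:] = 0"
proof -
  interpret pv: vector_space "\<lambda>q (p :: 'a poly). smult (of_rat q) p"
    by (rule smult_rat_vector_space)
  interpret of_rat: map_poly_comm_ring_hom "of_rat :: rat \<Rightarrow> 'a" ..
  \<comment> \<open>With \<open>b = card B\<close> this choice gives
    \<open>b * (4 b + 1) < (2 b + 1)^2\<close>.\<close>
  define N where "N = 2 * card B"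
  define I where "I = {..N} \<times> {..N}"
  define v where "v = (\<lambda>(i, j). monom 1 j * [:x, y:] ^ i)"
  define C where "C = (\<lambda>(b, l). monom b l) ` (B \<times> {..2 * N})"
  have coeffs: "coeff (v (i, j)) l \<in> rat_vs.span B" for i j l
    using coeff_linear_power_in_span[of x y B 0 0 i "l - j", OF assms(2)]
    by (simp add: v_def coeff_monom_mult rat_vs.span_zero)
  have "degree (v (i, j)) \<le> i + j" for i j
  proof -
    have "degree ([:x, y:] ^ i) \<le> i"
      using degree_power_le[of "[:x, y:]" i] by (simp split: if_splits)
    then show ?thesis
      unfolding v_def using degree_mult_le[of "monom 1 j" "[:x, y:] ^ i"] degree_monom_le[of "1::'a" j]
      by simp
  qed
  then have deg: "degree (v i) \<le> 2 * N" if "i \<in> I" for i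
    using that unfolding I_def by (cases i) (fastforce intro: order_trans)
  have "card C \<le> card B * (2 * N + 1)"
    unfolding C_def using card_image_le[of "B \<times> {..2 * N}"] assms(1)
    by (auto simp: card_cartesian_product intro: order_trans)
  also have "\<dots> < (N + 1) * (N + 1)"
    by (simp add: N_def algebra_simps)
  finally have "card C < card I" by (simp add: I_def card_cartesian_product)
  moreover have "v i \<in> pv.span C" if "i \<in> I" for i
    unfolding C_def using span_poly[OF assms(1) _ deg[OF that]] coeffs by (cases i) auto
  moreover have "finite I" "finite C" using assms(1) by (auto simp: I_def C_def)
  ultimately obtain c where c: "(\<Sum>i\<in>I. smult (of_rat (c i)) (v i)) = 0" "\<exists>i\<in>I. c i \<noteq> 0"
    using pv.ex_nontrivial_relation[of I C v] by metis
  define \<Psi> where "\<Psi> = (\<Sum>i\<le>N. monom (\<Sum>j\<le>N. monom (c (i, j)) j) i)"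
  have "coeff (coeff \<Psi> i) j = c (i, j)" if "i \<le> N" "j \<le> N" for i j
    using that by (simp add: \<Psi>_def coeff_sum)
  then have "\<Psi> \<noteq> 0" using c(2) unfolding I_def by force
  moreover have "biv_eval \<Psi> [:x, y:] = (\<Sum>i\<le>N. \<Sum>j\<le>N. smult (of_rat (c (i, j))) (v (i, j)))"
  proof -
    have "map_poly of_rat (\<Sum>j\<le>N. monom (c (i, j)) j) * [:x, y:] ^ i =
       (\<Sum>j\<le>N. smult (of_rat (c (i, j))) (v (i, j)))" for i
      unfolding of_rat.hom_sum sum_distrib_right v_def
      by (intro sum.cong refl) (simp add: smult_monom flip: mult_smult_left)
    then show ?thesis by (simp add: \<Psi>_def)
  qed
  ultimately show ?thesis using c(1) unfolding I_def by (auto simp: sum.cartesian_product)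
qed

text \<open>If \<open>\<Psi>(t, X)\<close> is a relation of minimal degree in \<open>X\<close> satisfied by \<open>x + t y\<close> over
  \<open>\<rat>(t)\<close>, then differentiating \<open>\<Psi>(t, x + t y) = 0\<close> with respect to \<open>t\<close> and specializing \<open>t\<close> to
  an integer \<open>k\<close> exhibits \<open>y\<close> as a rational function of \<open>x + k y\<close>.\<close>

lemma primitive_element_two:
  fixes x y :: "'a::field_char_0"
  assumes B: "finite B" "\<And>i j. x ^ i * y ^ j \<in> rat_vs.span B"
  obtains k where "x \<in> Qring (x + of_nat k * y)" "y \<in> Qring (x + of_nat k * y)"
    "Qring (x + of_nat k * y) \<subseteq> rat_vs.span B"
proof -
  let ?E = "\<lambda>\<Psi>. biv_eval \<Psi> [:x, y:]"
  obtain \<Psi> where \<Psi>: "\<Psi> \<noteq> 0" "?E \<Psi> = 0" and min: "\<And>\<Phi>. \<Phi> \<noteq> 0 \<Longrightarrow> ?E \<Phi> = 0 \<Longrightarrow> degree \<Psi> \<le> degree \<Phi>"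
    using ex_has_least_nat[of "\<lambda>\<Psi>. \<Psi> \<noteq> 0 \<and> ?E \<Psi> = 0" _ degree] ex_biv_eval_eq_0[OF B] by metis
  have "degree \<Psi> \<noteq> 0"
  proof
    assume "degree \<Psi> = 0"
    then obtain a where a: "\<Psi> = [:a:]" by (meson degree_eq_zeroE)
    then have "map_poly of_rat a = (0 :: 'a poly)" using \<Psi>(2) by simp
    then have "a = 0" by (simp add: poly_eq_iff coeff_map_poly)
    then show False using \<Psi>(1) a by simp
  qed
  \<comment> \<open>In characteristic 0 the derivative in \<open>X\<close> is nonzero and of smaller
    degree, so by minimality it does not vanish at \<open>x + t y\<close>, and some integer
    \<open>k\<close> avoids its finitely many roots.\<close>
  then have "pderiv \<Psi> \<noteq> 0" "degree (pderiv \<Psi>) < degree \<Psi>"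
    by (simp_all add: pderiv_eq_0_iff degree_pderiv)
  then have "?E (pderiv \<Psi>) \<noteq> 0" using min leD by blast
  then have "finite {t. poly (?E (pderiv \<Psi>)) t = 0}" by (rule poly_roots_finite)
  then have "finite (of_nat -` {t. poly (?E (pderiv \<Psi>)) t = 0} :: nat set)"
    by (rule finite_vimageI) (simp add: inj_on_def)
  then obtain k :: nat where k: "poly (?E (pderiv \<Psi>)) (of_nat k) \<noteq> 0"
    using ex_new_if_finite[of "of_nat -` {t. poly (?E (pderiv \<Psi>)) t = 0} :: nat set"] by auto
  define \<eta> where "\<eta> = x + of_nat k * y"
  let ?s = "map_poly (\<lambda>a. poly a (of_nat k))"
  have val: "poly (?E \<Phi>) (of_nat k) = rat_eval (?s \<Phi>) \<eta>" for \<Phi>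
    using poly_biv_eval[of \<Phi> "[:x, y:]" k] by (simp add: \<eta>_def mult.commute)
  \<comment> \<open>\<open>u\<close> and \<open>w\<close> are the partial derivatives in
    \<open>X\<close> and \<open>t\<close> at \<open>t = k\<close>; the derivative of
    \<open>x + t y\<close> in \<open>t\<close> is \<open>y\<close>, hence
    \<open>w + u * y = 0\<close>.\<close>
  define u where "u = rat_eval (?s (pderiv \<Psi>)) \<eta>"
  define w where "w = rat_eval (?s (map_poly pderiv \<Psi>)) \<eta>"
  have "poly (pderiv (?E \<Psi>)) (of_nat k) = w + u * y"
    unfolding pderiv_biv_eval poly_add poly_mult val by (simp add: u_def w_def pderiv_pCons)
  then have "w + u * y = 0" using \<Psi>(2) by simp
  moreover have "u \<noteq> 0" using k val u_def by simp
  ultimately have y: "y = - w * inverse u" by (simp add: field_simps eq_neg_iff_add_eq_0)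
  have pow: "x ^ a * y ^ b * \<eta> ^ i \<in> rat_vs.span B" for a b i
  proof (induction i arbitrary: a b)
    case (Suc i)
    have "x ^ a * y ^ b * \<eta> ^ Suc i =
        x ^ Suc a * y ^ b * \<eta> ^ i + of_rat (of_nat k) * (x ^ a * y ^ Suc b * \<eta> ^ i)"
      by (simp add: \<eta>_def algebra_simps)
    also have "\<dots> \<in> rat_vs.span B"
      by (intro rat_vs.span_add rat_vs.span_scale Suc)
    finally show ?case .
  qed (use B in auto)
  have sub: "Qring \<eta> \<subseteq> rat_vs.span B"
  proof -
    have "rat_eval P \<eta> \<in> rat_vs.span B" for P
      unfolding rat_eval_altdef[OF order_refl]
      using pow[of 0 0] by (intro rat_vs.span_sum rat_vs.span_scale) auto
    then show ?thesis by (auto simp: Qring_def)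
  qed
  then have "is_subfield (Qring \<eta>)" by (rule is_subfield_Qring[OF B(1)])
  then have "inverse u \<in> Qring \<eta>"
    using \<open>u \<noteq> 0\<close> by (simp add: is_subfield_def u_def Qring_I)
  moreover have "w \<in> Qring \<eta>" by (simp add: w_def Qring_I)
  ultimately have y': "y \<in> Qring \<eta>"
    unfolding y by (intro subring_closed[OF is_subring_Qring])
  then have "\<eta> - of_nat k * y \<in> Qring \<eta>"
    by (intro subring_closed[OF is_subring_Qring] Qring_self subring_of_nat[OF is_subring_Qring])
  then have "x \<in> Qring \<eta>" by (simp add: \<eta>_def)
  with y' sub show ?thesis using that unfolding \<eta>_def by blast
qed

text \<open>A finite spanning set is absorbed one element at a time, each time merging two
  generators into one.\<close>

lemma primitive_element:
  fixes K :: "'a::field_char_0 set"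
  assumes K: "number_field K"
  obtains \<theta> where "\<theta> \<in> K" "K = Qring \<theta>"
proof -
  obtain B where B: "finite B" "rat_vs.span B = K" and sub: "is_subfield K"
    using K by (auto simp: number_field_def)
  note R = subfield_is_subring[OF sub]
  have "\<exists>\<theta>\<in>K. C \<subseteq> Qring \<theta>" if "finite C" "C \<subseteq> K" for C
    using that
  proof (induction C)
    case empty
    then show ?case using subring_closed(1)[OF R] by blast
  next
    case (insert y C)
    then obtain x where x: "x \<in> K" "C \<subseteq> Qring x" by auto
    have "x ^ i * y ^ j \<in> rat_vs.span B" for i j
      unfolding B using x insert.prems by (intro subring_closed[OF R] subring_power[OF R]) auto
    then obtain k where k: "x \<in> Qring (x + of_nat k * y)" "y \<in> Qring (x + of_nat k * y)"
      using primitive_element_two[OF B(1)] by blast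
    have "x + of_nat k * y \<in> K"
      using x insert.prems by (intro subring_closed[OF R] subring_of_nat[OF R]) auto
    with k x Qring_mono show ?case by blast
  qed
  then obtain \<theta> where \<theta>: "\<theta> \<in> K" "B \<subseteq> Qring \<theta>"
    using B rat_vs.span_superset by metis
  have "K \<subseteq> Qring \<theta>"
    using rat_vs.span_minimal[OF \<theta>(2) subspace_Qring] B by simp
  moreover have "Qring \<theta> \<subseteq> K"
    using \<theta>(1) subfield_rat_eval[OF sub] by (auto simp: Qring_def)
  ultimately show ?thesis using that \<theta>(1) by blast
qed

section \<open>Annihilating polynomials and specialization modulo primes\<close>

lemma Qring_subset_span_powers:
  assumes "P \<noteq> 0" "rat_eval P x = 0"
  shows "Qring x \<subseteq> rat_vs.span ((\<lambda>i. x ^ i) ` {..<degree P})"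
proof -
  have "degree P \<noteq> 0" using assms by (auto elim!: degree_eq_zeroE)
  have "rat_eval Q x \<in> rat_vs.span ((\<lambda>i. x ^ i) ` {..<degree P})" for Q
  proof -
    have "rat_eval Q x = rat_eval (Q div P * P + Q mod P) x" by simp
    also have "\<dots> = rat_eval (Q mod P) x"
      by (simp only: rat_eval_simps assms(2)) simp
    also have "\<dots> = (\<Sum>i\<le>degree P - 1. of_rat (coeff (Q mod P) i) * x ^ i)"
      using degree_mod_less'[of P Q] \<open>degree P \<noteq> 0\<close> assms(1)
      by (intro rat_eval_altdef) (cases "Q mod P = 0"; simp)
    also have "\<dots> \<in> rat_vs.span ((\<lambda>i. x ^ i) ` {..<degree P})"
      using \<open>degree P \<noteq> 0\<close>
      by (intro rat_vs.span_sum rat_vs.span_scale rat_vs.span_base) auto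
    finally show ?thesis .
  qed
  then show ?thesis by (auto simp: Qring_def)
qed

lemma degree_annihilator_ge:
  assumes "P \<noteq> 0" "rat_eval P x = 0"
  shows "field_degree (Qring x) \<le> degree P"
proof -
  have "rat_vs.dim (Qring x) \<le> card ((\<lambda>i. x ^ i) ` {..<degree P})"
    by (rule rat_vs.dim_le_card[OF Qring_subset_span_powers[OF assms]]) simp
  also have "\<dots> \<le> degree P" using card_image_le[of "{..<degree P}"] by simp
  finally show ?thesis by (simp add: field_degree_def)
qed

lemma adjoin_Q_eq_Qring:
  assumes "is_subfield (Qring x)"
  shows "adjoin_Q x = Qring x"
  unfolding adjoin_Q_def
proof (rule hull_unique)
  fix F :: "'a set" assume "{x} \<subseteq> F" "is_subfield F"
  then show "Qring x \<subseteq> F" using subfield_rat_eval by (auto simp: Qring_def)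
qed (use assms Qring_self in auto)

text \<open>Among \<open>[Q(x) : Q] + 1\<close> powers there is a relation, and
  \<open>degree_annihilator_ge\<close> excludes a smaller degree; clearing denominators and dividing
  by the content makes it primitive.\<close>

lemma primitive_int_annihilator:
  assumes "number_field (Qring x)"
  obtains g where "degree g = field_degree (Qring x)" "content g = 1" "int_eval g x = 0"
proof -
  obtain B where B: "finite B" "rat_vs.span B = Qring x"
    using assms by (auto simp: number_field_def)
  obtain C where C: "C \<subseteq> Qring x" "rat_vs.independent C" "Qring x \<subseteq> rat_vs.span C"
      "card C = rat_vs.dim (Qring x)"
    using rat_vs.basis_exists by blast
  have "finite C" using rat_vs.independent_span_bound[OF B(1) C(2)] B(2) C(1) by simp
  moreover have "x ^ i \<in> rat_vs.span C" for i
    using C(3) subring_power[OF is_subring_Qring Qring_self] by blast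
  ultimately obtain P where P: "P \<noteq> 0" "degree P \<le> card C" "rat_eval P x = 0"
    using algebraic_if_powers_in_span by blast
  then have deg: "degree P = field_degree (Qring x)"
    using degree_annihilator_ge[OF P(1,3)] C(4) by (simp add: field_degree_def)
  obtain D and Q :: "int poly" where DQ: "D > 0" "of_int_poly Q = smult (of_int D) P"
    using clear_denominators by blast
  have "Q \<noteq> 0" using DQ P(1) by auto
  show ?thesis
  proof (rule that[of "primitive_part Q"])
    have "degree Q = degree (of_int_poly Q :: rat poly)" by simp
    then show "degree (primitive_part Q) = field_degree (Qring x)"
      using DQ deg by simp
    show "content (primitive_part Q) = 1" using \<open>Q \<noteq> 0\<close> by simp
    have "of_int (content Q) * int_eval (primitive_part Q) x = int_eval Q x"
      by (simp flip: int_eval_simps(9))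
    also have "\<dots> = 0"
      using P(3) DQ(2) by (simp flip: rat_eval_of_int_poly)
    finally show "int_eval (primitive_part Q) x = 0"
      using \<open>Q \<noteq> 0\<close> by simp
  qed
qed

text \<open>Over the rationals the remainder modulo \<open>m\<close> vanishes by minimality;
  \<open>D\<close> is a denominator of the quotient.\<close>

lemma minimal_annihilator_dvd:
  fixes x :: "'a::field_char_0"
  assumes m: "m \<noteq> 0" "int_eval m x = 0"
    and min: "\<And>P. P \<noteq> 0 \<Longrightarrow> int_eval P x = 0 \<Longrightarrow> degree m \<le> degree P"
    and P: "int_eval P x = 0"
  obtains D w where "D > 0" "smult D P = m * w"
proof -
  define M where "M = (of_int_poly m :: rat poly)"
  define R where "R = of_int_poly P mod M"
  obtain D and Q :: "int poly" where DQ: "D > 0" "of_int_poly Q = smult (of_int D) R"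
    using clear_denominators by blast
  have M: "M \<noteq> 0" "degree M = degree m" "rat_eval M x = 0"
    using m by (simp_all add: M_def rat_eval_of_int_poly)
  have "rat_eval (of_int_poly P div M * M + R) x = 0"
    using P by (simp add: R_def rat_eval_of_int_poly)
  then have "int_eval Q x = 0"
    using M(3) DQ(2) by (simp flip: rat_eval_of_int_poly)
  have "R = 0"
  proof (rule ccontr)
    assume "R \<noteq> 0"
    then have "degree R < degree m"
      using degree_mod_less'[of M "of_int_poly P"] M by (simp add: R_def)
    moreover have "degree (of_int_poly Q :: rat poly) = degree R" "Q \<noteq> 0"
      using DQ \<open>R \<noteq> 0\<close> by auto
    ultimately show False using min[of Q] \<open>int_eval Q x = 0\<close> by simp
  qed
  then have PM: "of_int_poly P = M * (of_int_poly P div M)"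
    unfolding R_def by (metis dvd_eq_mod_eq_0 dvd_mult_div_cancel)
  obtain D' and w :: "int poly" where D': "D' > 0" "of_int_poly w = smult (of_int D') (of_int_poly P div M)"
    using clear_denominators by blast
  have "of_int_poly (smult D' P) = (of_int_poly (m * w) :: rat poly)"
    using PM D'(2) by (simp add: hom_distribs M_def)
  then have "smult D' P = m * w"
    using of_int_poly_hom.injectivity by blast
  with D'(1) show ?thesis by (rule that)
qed

section \<open>Prime divisors of polynomial values and reduction modulo a prime\<close>

lemma ex_prime_divisor_of_value:
  fixes m :: "int poly"
  assumes "degree m > 0" "E \<noteq> 0"
  obtains p :: nat and b where "prime p" "\<not> int p dvd E" "int p dvd poly m b"
proof (cases "coeff m 0 = 0")
  case True
  obtain p where p: "prime p" "nat \<bar>E\<bar> < p" using bigger_prime by blast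
  then have "\<not> int p dvd E" using assms(2) zdvd_not_zless[of "\<bar>E\<bar>" "int p"] by auto
  moreover have "int p dvd poly m 0" using True by (simp add: poly_0_coeff_0)
  ultimately show ?thesis using that p(1) by blast
next
  case False
  define c where "c = coeff m 0"
  obtain q where q: "m = pCons c q" by (cases m) (simp add: c_def)
  \<comment> \<open>Euclid's argument: \<open>m(c E t) = c * v\<close> with
    \<open>v \<equiv> 1\<close> modulo \<open>E\<close>, so no prime divisor of \<open>v\<close>
    divides \<open>E\<close>. Avoiding \<open>S\<close> keeps the value away from \<open>c\<close>
    and \<open>- c\<close>, so \<open>v\<close> is not a unit.\<close>
  define S where "S = {x. poly (m - [:c:]) x = 0} \<union> {x. poly (m - [:- c:]) x = 0}"
  have "m - [:c:] \<noteq> 0" "m - [:- c:] \<noteq> 0"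
    using assms(1) by auto
  then have "finite S"
    by (simp only: S_def finite_Un poly_roots_finite simp_thms)
  then have "finite ((\<lambda>t. c * E * t) -` S)"
    by (rule finite_vimageI) (use False assms(2) in \<open>simp add: inj_on_def c_def\<close>)
  then obtain t where "t \<notin> (\<lambda>t. c * E * t) -` S"
    using ex_new_if_finite[OF infinite_UNIV_int] by blast
  then have t: "poly m (c * E * t) \<noteq> c" "poly m (c * E * t) \<noteq> - c"
    by (simp_all add: S_def)
  define v where "v = 1 + E * t * poly q (c * E * t)"
  have v: "poly m (c * E * t) = c * v" by (simp add: q v_def algebra_simps)
  have "\<bar>v\<bar> \<noteq> 1" using t unfolding v by (auto simp: abs_if split: if_splits)
  then obtain p' where p': "p' dvd v" "prime p'"
    using prime_factor_int[of v] by blast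
  define p where "p = nat p'"
  have p: "int p = p'" "prime p"
    using p'(2) prime_ge_0_int[of p'] by (auto simp: p_def)
  have "\<not> p' dvd E"
  proof
    assume "p' dvd E"
    then have "p' dvd E * t * poly q (c * E * t)" by simp
    with p'(1) have "p' dvd 1" unfolding v_def using dvd_add_left_iff by blast
    then show False using p'(2) not_prime_unit by blast
  qed
  then show ?thesis using that[of p "c * E * t"] p p'(1) v by auto
qed

text \<open>A minimal annihilator \<open>m\<close> of \<open>x\<close> divides every
  \<open>P\<close> in \<open>Ps\<close> up to a denominator. A root \<open>b\<close> of
  \<open>m\<close> modulo a prime avoiding those denominators is then a reduction of
  \<open>x\<close> that respects all the given relations.\<close>

lemma ex_prime_specialization:
  fixes x :: "'a::field_char_0"
  assumes alg: "P0 \<noteq> 0" "rat_eval P0 x = 0"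
    and Ps: "finite Ps" "\<And>P. P \<in> Ps \<Longrightarrow> int_eval P x = 0" and E: "E \<noteq> 0"
  obtains p :: nat and b where "prime p" "\<not> int p dvd E" "\<And>P. P \<in> Ps \<Longrightarrow> int p dvd poly P b"
proof -
  obtain D0 and Q0 :: "int poly" where Q0: "D0 > 0" "of_int_poly Q0 = smult (of_int D0) P0"
    using clear_denominators by blast
  then have "Q0 \<noteq> 0 \<and> int_eval Q0 x = 0"
    using alg by (auto simp flip: rat_eval_of_int_poly)
  then obtain m where m: "m \<noteq> 0" "int_eval m x = 0"
      and min: "\<And>P. P \<noteq> 0 \<Longrightarrow> int_eval P x = 0 \<Longrightarrow> degree m \<le> degree P"
    using ex_has_least_nat[of "\<lambda>P. P \<noteq> 0 \<and> int_eval P x = 0" Q0 degree] by blast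
  have deg: "degree m > 0" using m by (cases "degree m = 0") (auto elim!: degree_eq_zeroE)
  have "\<exists>D w. D > 0 \<and> smult D P = m * w" if "P \<in> Ps" for P
    using minimal_annihilator_dvd[OF m min Ps(2)[OF that]] by metis
  then obtain D w where Dw: "\<And>P. P \<in> Ps \<Longrightarrow> D P > (0::int) \<and> smult (D P) P = m * w P" by metis
  have "E * (\<Prod>P\<in>Ps. D P) \<noteq> 0" using Dw Ps(1) E by fastforce
  then obtain p b where p: "prime (p::nat)" "\<not> int p dvd E * (\<Prod>P\<in>Ps. D P)" "int p dvd poly m b"
    using ex_prime_divisor_of_value[OF deg] by metis
  have "int p dvd poly P b" if "P \<in> Ps" for P
  proof -
    have "D P * poly P b = poly m b * poly (w P) b"
      using Dw[OF that] by (metis poly_mult poly_smult)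
    then have "int p dvd D P * poly P b" using p(3) by simp
    moreover have "\<not> int p dvd D P"
      using p(2) Ps(1) that by (meson dvd_mult dvd_prod dvd_trans)
    ultimately show ?thesis using p(1) by (simp add: prime_dvd_mult_iff)
  qed
  moreover have "\<not> int p dvd E" using p(2) by (meson dvd_mult2)
  ultimately show ?thesis using that[of p b] p(1) by blast
qed

lemma rat_vs_span_mult:
  assumes "finite A" "finite C" "u \<in> rat_vs.span A" "v \<in> rat_vs.span C"
  shows "u * v \<in> rat_vs.span ((\<lambda>(a, c). a * c) ` (A \<times> C))"
proof -
  obtain f h where "u = (\<Sum>a\<in>A. of_rat (f a) * a)" "v = (\<Sum>c\<in>C. of_rat (h c) * c)"
    using assms by (auto simp: rat_vs.span_finite)
  then have "u * v = (\<Sum>a\<in>A. \<Sum>c\<in>C. of_rat (f a * h c) * (a * c))"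
    by (simp add: sum_product of_rat_mult algebra_simps)
  also have "\<dots> \<in> rat_vs.span ((\<lambda>(a, c). a * c) ` (A \<times> C))"
    by (intro rat_vs.span_sum rat_vs.span_scale rat_vs.span_base) auto
  finally show ?thesis .
qed

section \<open>A generator whose leading coefficient is a primitive root\<close>

lemma sum_powers_root_of_unity:
  fixes n d :: nat
  assumes "0 < d" "d < n"
  defines "\<zeta> \<equiv> cis (2 * pi / real n)"
  shows "(\<Sum>j<n. \<zeta> ^ (d * j)) = 0"
proof -
  have pow: "\<zeta> ^ k = cis (2 * pi * real k / real n)" for k
    by (simp add: \<zeta>_def DeMoivre mult.commute)
  have "inj_on (\<lambda>k. cis (2 * pi * real k / real n)) {..<n}"
    using bij_betw_roots_unity[of n] assms by (simp add: bij_betw_def)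
  then have "cis (2 * pi * real d / real n) \<noteq> cis (2 * pi * real 0 / real n)"
    using assms by (subst inj_on_eq_iff) auto
  then have "\<zeta> ^ d \<noteq> 1" unfolding pow by simp
  moreover have "(\<zeta> ^ d) ^ n = (\<zeta> ^ n) ^ d"
    by (simp flip: power_mult add: mult.commute)
  moreover have "\<zeta> ^ n = 1"
    unfolding pow using assms(1,2) by simp
  ultimately show ?thesis
    unfolding power_mult by (simp add: geometric_sum)
qed

text \<open>If \<open>z ^ d \<equiv> 1\<close> modulo \<open>p\<close> for some
  \<open>0 < d < n\<close>, the sum would be congruent to \<open>n\<close>, which \<open>p\<close>
  does not divide; the sum for \<open>d = 1\<close> gives \<open>z ^ n \<equiv> 1\<close>. So
  \<open>z\<close> has order exactly \<open>n\<close> modulo \<open>p\<close>. Such sums are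
  relations that pass from a root of unity to its reductions.\<close>

lemma ord_eqI_geometric_sums:
  fixes z :: int and n p :: nat
  assumes "prime p" "\<not> p dvd n" "n \<ge> 2"
    and sums: "\<And>d. 0 < d \<Longrightarrow> d < n \<Longrightarrow> int p dvd (\<Sum>j<n. z ^ (d * j))"
  shows "n dvd p - 1"
proof -
  have not1: "\<not> [z ^ d = 1] (mod int p)" if "0 < d" "d < n" for d
  proof
    assume "[z ^ d = 1] (mod int p)"
    then have "[(\<Sum>j<n. (z ^ d) ^ j) = (\<Sum>j<n. 1 ^ j)] (mod int p)"
      by (intro cong_sum cong_pow)
    then have "int p dvd int n"
      using sums[OF that] by (simp add: power_mult cong_dvd_iff)
    then show False using assms(2) by simp
  qed
  have "(z - 1) * (\<Sum>j<n. z ^ j) = z ^ n - 1"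
    by (simp add: power_diff_1_eq)
  moreover have "int p dvd (\<Sum>j<n. z ^ j)"
    using sums[of 1] assms(3) by simp
  ultimately have zn: "[z ^ n = 1] (mod int p)"
    unfolding cong_iff_dvd_diff by (metis dvd_mult)
  define y where "y = nat (z mod int p)"
  have y: "[int y = z] (mod int p)"
    using prime_gt_0_nat[OF assms(1)] by (simp add: y_def cong_def)
  have iff: "[y ^ d = 1] (mod p) \<longleftrightarrow> [z ^ d = 1] (mod int p)" for d
  proof -
    have "[y ^ d = 1] (mod p) \<longleftrightarrow> [int (y ^ d) = int 1] (mod int p)"
      by (simp only: cong_int_iff)
    also have "\<dots> \<longleftrightarrow> [z ^ d = 1] (mod int p)"
      using cong_pow[OF y, of d] by (metis cong_sym cong_trans of_nat_1 of_nat_power)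
    finally show ?thesis .
  qed
  have "[y ^ n = 1] (mod p)" using zn iff by simp
  then have "ord p y dvd n" by (simp only: ord_divides)
  moreover have "ord p y > 0"
    using dvd_pos_nat[OF _ \<open>ord p y dvd n\<close>] assms(3) by linarith
  moreover have "[y ^ ord p y = 1] (mod p)" by (rule ord)
  ultimately have "ord p y = n"
    using not1[of "ord p y"] iff assms(3) dvd_imp_le[of "ord p y" n] by fastforce
  moreover have "coprime p y"
    using \<open>ord p y > 0\<close> ord_gt_0_iff by blast
  ultimately show ?thesis
    using order_divides_totient[of p y] assms(1) by (simp add: totient_prime)
qed

text \<open>A root \<open>\<theta>\<close> of \<open>g\<close> and a primitive \<open>n\<close>-th
  root of unity are polynomials in one element \<open>\<eta>\<close>. Reducing \<open>\<eta>\<close>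
  to \<open>b\<close> modulo \<open>p\<close> turns them into a root of \<open>g\<close> modulo
  \<open>p\<close> and an element of order \<open>n\<close>, whence
  \<open>n dvd p - 1\<close>.\<close>

lemma ex_prime_cong_1_with_root:
  fixes g :: "int poly" and n :: nat
  assumes g: "degree g > 0" and E: "E \<noteq> 0" and n: "n \<ge> 2"
  obtains p :: nat and a where "prime p" "n dvd p - 1" "\<not> int p dvd E" "int p dvd poly g a"
proof -
  have "\<not> constant (poly (of_int_poly g :: complex poly))"
    using g by (simp add: constant_degree)
  then obtain \<theta> :: complex where \<theta>: "int_eval g \<theta> = 0"
    using fundamental_theorem_of_algebra unfolding int_eval_def by blast
  define \<zeta> where "\<zeta> = cis (2 * pi / real n)"
  have \<zeta>: "(\<Sum>j<n. \<zeta> ^ (d * j)) = 0" if "0 < d" "d < n" for d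
    using sum_powers_root_of_unity[OF that] by (simp add: \<zeta>_def)
  \<comment> \<open>Products of powers span the compositum; \<open>1 + X + ... + X^(n - 1)\<close>
    serves as the annihilator of \<open>\<zeta>\<close>.\<close>
  define B where "B = (\<lambda>(a, c). a * c) ` ((\<lambda>i. \<theta> ^ i) ` {..<degree g} \<times> (\<lambda>i. \<zeta> ^ i) ` {..<degree (\<Sum>j<n. monom (1::rat) j)})"
  have B: "finite B" by (simp add: B_def)
  have "\<theta> ^ i * \<zeta> ^ j \<in> rat_vs.span B" for i j
    unfolding B_def
  proof (rule rat_vs_span_mult)
    have "Qring \<theta> \<subseteq> rat_vs.span ((\<lambda>i. \<theta> ^ i) ` {..<degree (of_int_poly g :: rat poly)})"
      using g \<theta> by (intro Qring_subset_span_powers) (auto simp: rat_eval_of_int_poly)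
    then show "\<theta> ^ i \<in> rat_vs.span ((\<lambda>i. \<theta> ^ i) ` {..<degree g})"
      using subring_power[OF is_subring_Qring Qring_self] by auto
    have "coeff (\<Sum>j<n. monom (1::rat) j) 0 = 1" using n by (simp add: coeff_sum)
    then have "(\<Sum>j<n. monom (1::rat) j) \<noteq> 0" by (metis coeff_0 zero_neq_one)
    moreover have "rat_eval (\<Sum>j<n. monom 1 j) \<zeta> = 0" using \<zeta>[of 1] n by simp
    ultimately show "\<zeta> ^ j \<in> rat_vs.span ((\<lambda>i. \<zeta> ^ i) ` {..<degree (\<Sum>j<n. monom (1::rat) j)})"
      using Qring_subset_span_powers subring_power[OF is_subring_Qring Qring_self] by blast
  qed auto
  then obtain k where k: "\<theta> \<in> Qring (\<theta> + of_nat k * \<zeta>)" "\<zeta> \<in> Qring (\<theta> + of_nat k * \<zeta>)"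
      "Qring (\<theta> + of_nat k * \<zeta>) \<subseteq> rat_vs.span B"
    using primitive_element_two[OF B] by blast
  define \<eta> where "\<eta> = \<theta> + of_nat k * \<zeta>"
  have "\<eta> ^ i \<in> rat_vs.span B" for i
    using subsetD[OF k(3)] subring_power[OF is_subring_Qring Qring_self, of \<eta> i]
    by (simp add: \<eta>_def)
  then obtain P0 where P0: "P0 \<noteq> 0" "rat_eval P0 \<eta> = 0"
    using algebraic_if_powers_in_span[OF B] by metis
  obtain A C where AC: "\<theta> = rat_eval A \<eta>" "\<zeta> = rat_eval C \<eta>"
    using k(1,2) by (auto simp: \<eta>_def[symmetric] Qring_def)
  obtain D1 and A1 :: "int poly" where A1: "D1 > 0" "of_int_poly A1 = smult (of_int D1) A"
    using clear_denominators by blast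
  obtain D2 and C2 :: "int poly" where C2: "D2 > 0" "of_int_poly C2 = smult (of_int D2) C"
    using clear_denominators by blast
  \<comment> \<open>\<open>D\<close> is a common denominator: \<open>U\<close> and \<open>V\<close>
    have integer coefficients and take the values \<open>D * \<theta>\<close> and
    \<open>D * \<zeta>\<close> at \<open>\<eta>\<close>.\<close>
  define D where "D = D1 * D2"
  define U where "U = smult D2 A1"
  define V where "V = smult D1 C2"
  have "D \<noteq> 0" using A1 C2 by (simp add: D_def)
  have "int_eval A1 \<eta> = of_int D1 * \<theta>" "int_eval C2 \<eta> = of_int D2 * \<zeta>"
    using A1(2) C2(2) AC by (simp_all flip: rat_eval_of_int_poly)
  then have U: "int_eval U \<eta> = of_int D * \<theta>" and V: "int_eval V \<eta> = of_int D * \<zeta>"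
    by (simp_all add: U_def V_def D_def)
  \<comment> \<open>Homogenizing with powers of \<open>D\<close> gives integer polynomials:
    \<open>G(\<eta>)\<close> is \<open>D ^ degree g * g(\<theta>)\<close>, and \<open>S d\<close>
    takes a multiple of the vanishing sum in \<open>\<zeta> ^ d\<close>.\<close>
  define G where "G = (\<Sum>i\<le>degree g. smult (coeff g i * D ^ (degree g - i)) (U ^ i))"
  define S where "S = (\<lambda>d. \<Sum>j<n. smult (D ^ (d * (n - 1 - j))) (V ^ (d * j)))"
  have D_split: "D ^ (m - i) * D ^ i = D ^ m" if "i \<le> m" for i m
    using that by (simp flip: power_add)
  have D_split': "D ^ (d * (n - 1 - j)) * D ^ (d * j) = D ^ (d * (n - 1))" if "j < n" for d j
    using that by (simp flip: power_add distrib_left)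
  have "int_eval G \<eta> = of_int (D ^ degree g) * int_eval g \<theta>"
    unfolding int_eval_altdef[OF order_refl, of g] G_def int_eval_simps sum_distrib_left
  proof (intro sum.cong refl)
    fix i assume "i \<in> {..degree g}"
    then show "of_int (coeff g i * D ^ (degree g - i)) * int_eval U \<eta> ^ i =
        of_int (D ^ degree g) * (of_int (coeff g i) * \<theta> ^ i)"
      using D_split[of i "degree g"] by (simp add: U power_mult_distrib flip: of_int_power of_int_mult)
  qed
  then have G0: "int_eval G \<eta> = 0" using \<theta> by simp
  have S0: "int_eval (S d) \<eta> = 0" if "0 < d" "d < n" for d
  proof -
    have "int_eval (S d) \<eta> = (\<Sum>j<n. of_int (D ^ (d * (n - 1))) * \<zeta> ^ (d * j))"
      unfolding S_def int_eval_simps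
    proof (intro sum.cong refl)
      fix j assume "j \<in> {..<n}"
      then show "of_int (D ^ (d * (n - 1 - j))) * int_eval V \<eta> ^ (d * j) = of_int (D ^ (d * (n - 1))) * \<zeta> ^ (d * j)"
        using D_split'[of j d] by (simp add: V power_mult_distrib flip: of_int_power of_int_mult mult.assoc)
    qed
    then show ?thesis using \<zeta>[OF that] by (simp flip: sum_distrib_left)
  qed
  \<comment> \<open>The prime avoids \<open>D\<close>, so that the denominator can be inverted, and
    \<open>n\<close>, so that the order criterion applies.\<close>
  have "E * D * int n \<noteq> 0" using E \<open>D \<noteq> 0\<close> n by simp
  moreover have "int_eval P \<eta> = 0" if "P \<in> insert G (S ` {0<..<n})" for P
    using that G0 S0 by auto
  ultimately obtain p :: nat and b where p: "prime p" "\<not> int p dvd E * D * int n"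
      and pS: "\<And>P. P \<in> insert G (S ` {0<..<n}) \<Longrightarrow> int p dvd poly P b"
    using ex_prime_specialization[OF P0, of "insert G (S ` {0<..<n})" "E * D * int n"] by auto
  have pG: "int p dvd poly G b" using pS by simp
  have pSd: "int p dvd poly (S d) b" if "0 < d" "d < n" for d using pS that by simp
  have pE: "\<not> int p dvd E" and pD: "\<not> int p dvd D" and pn: "\<not> p dvd n"
    using p(2) by auto
  have "coprime D (int p)"
    using p(1) pD by (metis coprime_commute prime_imp_coprime prime_nat_int_transfer)
  then obtain D' where "[D * D' = 1] (mod int p)" using cong_solve_coprime_int by blast
  \<comment> \<open>\<open>a\<close> and \<open>z\<close> are the reductions of
    \<open>\<theta>\<close> and \<open>\<zeta>\<close> modulo \<open>p\<close>.\<close>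
  define a where "a = D' * poly U b"
  define z where "z = D' * poly V b"
  have inv: "[D * (D' * x) = x] (mod int p)" for x
    using cong_scalar_right[OF \<open>[D * D' = 1] (mod int p)\<close>, of x] by (simp add: mult.assoc)
  have Da: "[poly U b = D * a] (mod int p)" and Dz: "[poly V b = D * z] (mod int p)"
    using inv by (simp_all add: a_def z_def cong_sym)
  have "[poly G b = (\<Sum>i\<le>degree g. coeff g i * D ^ (degree g - i) * (D * a) ^ i)] (mod int p)"
    unfolding G_def poly_sum poly_smult poly_power by (intro cong_sum cong_mult cong_pow Da cong_refl)
  also have "(\<Sum>i\<le>degree g. coeff g i * D ^ (degree g - i) * (D * a) ^ i) = D ^ degree g * poly g a"
    unfolding poly_altdef sum_distrib_left
    using D_split by (intro sum.cong refl) (simp add: power_mult_distrib mult_ac)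
  finally have "int p dvd D ^ degree g * poly g a"
    using pG by (simp add: cong_dvd_iff)
  then have root: "int p dvd poly g a"
    using p(1) pD by (simp add: prime_dvd_mult_iff prime_dvd_power_iff) (metis prime_dvd_power prime_nat_int_transfer)
  have "int p dvd (\<Sum>j<n. z ^ (d * j))" if "0 < d" "d < n" for d
  proof -
    have "[poly (S d) b = (\<Sum>j<n. D ^ (d * (n - 1 - j)) * (D * z) ^ (d * j))] (mod int p)"
      unfolding S_def poly_sum poly_smult poly_power by (intro cong_sum cong_mult cong_pow Dz cong_refl)
    also have "(\<Sum>j<n. D ^ (d * (n - 1 - j)) * (D * z) ^ (d * j)) = D ^ (d * (n - 1)) * (\<Sum>j<n. z ^ (d * j))"
      unfolding sum_distrib_left
      using D_split' by (intro sum.cong refl) (simp add: power_mult_distrib flip: mult.assoc)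
    finally have "int p dvd D ^ (d * (n - 1)) * (\<Sum>j<n. z ^ (d * j))"
      using pSd[OF that] by (simp add: cong_dvd_iff)
    then show ?thesis
      using p(1) pD by (simp add: prime_dvd_mult_iff) (metis prime_dvd_power prime_nat_int_transfer)
  qed
  then have "n dvd p - 1" by (intro ord_eqI_geometric_sums p(1) pn n)
  then show ?thesis using that p(1) pE root by blast
qed

text \<open>With \<open>g(a0) = p m\<close>, Taylor expansion gives
  \<open>g(a0 + p t) / p \<equiv> m + g'(a0) t\<close> modulo \<open>p\<close>; since
  \<open>g'(a0)\<close> is invertible, this takes every residue.\<close>

lemma lift_root_mod_prime_square:
  fixes g :: "int poly" and p :: nat
  assumes "prime p" "int p dvd poly g a0" "\<not> int p dvd poly (pderiv g) a0"
  obtains a c where "poly g a = int p * c" "[c = r] (mod int p)"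
proof -
  define h where "h = pcompose g [:a0, 1:]"
  obtain h0 h1 h2 where h: "h = pCons h0 (pCons h1 h2)" by (metis pCons_cases)
  have "poly h 0 = poly g a0" "poly (pderiv h) 0 = poly (pderiv g) a0"
    by (simp_all add: h_def poly_pcompose pderiv_pcompose pderiv_pCons)
  then have h01: "h0 = poly g a0" "h1 = poly (pderiv g) a0"
    by (simp_all add: h pderiv_pCons)
  obtain m where m: "h0 = int p * m" using assms(2) h01 by auto
  have "coprime h1 (int p)"
    using assms(1,3) h01 by (metis coprime_commute prime_imp_coprime prime_nat_int_transfer)
  then obtain s where s: "[h1 * s = 1] (mod int p)" using cong_solve_coprime_int by blast
  define t where "t = s * (r - m)"
  show ?thesis
  proof (rule that)
    have "poly g (a0 + int p * t) = poly h (int p * t)"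
      by (simp add: h_def poly_pcompose)
    then show "poly g (a0 + int p * t) = int p * (m + h1 * t + int p * (t * t * poly h2 (int p * t)))"
      by (simp add: h m algebra_simps)
    have "[m + h1 * t + int p * (t * t * poly h2 (int p * t)) = m + (h1 * s) * (r - m) + 0] (mod int p)"
      unfolding t_def by (intro cong_add cong_refl) (simp_all add: mult.assoc cong_0_iff)
    also have "[m + (h1 * s) * (r - m) + 0 = m + 1 * (r - m) + 0] (mod int p)"
      by (intro cong_add cong_mult cong_refl s)
    finally show "[m + h1 * t + int p * (t * t * poly h2 (int p * t)) = r] (mod int p)"
      by simp
  qed
qed

text \<open>The shift is undone by the opposite shift, so a constant dividing the shifted polynomial
  divides \<open>g\<close>.\<close>

lemma content_pcompose_shift:
  fixes g :: "int poly"
  assumes "content g = 1" "[:d:] dvd pcompose g [:a, 1:]"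
  shows "is_unit d"
proof -
  obtain h where h: "pcompose g [:a, 1:] = [:d:] * h" using assms(2) by auto
  have "g = pcompose (pcompose g [:a, 1:]) [:- a, 1:]"
    by (simp add: pcompose_assoc[symmetric] pcompose_pCons)
  also have "\<dots> = [:d:] * pcompose h [:- a, 1:]"
    unfolding h by (simp add: pcompose_smult)
  finally have "[:d:] dvd g" by (rule dvdI)
  then show ?thesis using assms(1) by (simp add: const_poly_dvd_iff_dvd_content)
qed

lemma ex_generator_with_primroot_lead_coeff:
  fixes K :: "'a::field_char_0 set"
  assumes K: "number_field K" and n: "n = field_degree K" "n \<ge> 3"
  obtains p r :: nat and \<alpha> and f :: "int poly" where
    "prime p" "n dvd p - 1" "K = Qring \<alpha>" "degree f = n" "content f = 1" "int_eval f \<alpha> = 0"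
    "residue_primroot p r" "[lead_coeff f = int r] (mod int p)"
proof -
  obtain \<theta> where \<theta>: "K = Qring \<theta>" using primitive_element[OF K] by metis
  obtain g where g: "degree g = n" "content g = 1" "int_eval g \<theta> = 0"
    using primitive_int_annihilator K unfolding \<theta> n(1) by metis
  have min: "n \<le> degree P" if "P \<noteq> 0" "int_eval P \<theta> = 0" for P
    using degree_annihilator_ge[of "of_int_poly P" \<theta>] that n(1) \<theta>
    by (simp add: rat_eval_of_int_poly)
  have sub: "is_subfield K" using K by (simp add: number_field_def)
  note R = subfield_is_subring[OF sub]
  have "degree (pderiv g) < n" "pderiv g \<noteq> 0"
    using g n by (auto simp: degree_pderiv pderiv_eq_0_iff)
  then have g'0: "int_eval (pderiv g) \<theta> \<noteq> 0" using min leD by blast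
  have "int_eval (pderiv g) \<theta> \<in> K"
    unfolding \<theta> by (intro subring_int_eval is_subring_Qring Qring_self)
  then have "inverse (int_eval (pderiv g) \<theta>) \<in> K"
    using g'0 sub by (simp add: is_subfield_def)
  then obtain H where H: "inverse (int_eval (pderiv g) \<theta>) = rat_eval H \<theta>"
    unfolding \<theta> Qring_def by blast
  obtain D and H1 :: "int poly" where D: "D > 0" "of_int_poly H1 = smult (of_int D) H"
    using clear_denominators by blast
  have "int_eval H1 \<theta> = of_int D * inverse (int_eval (pderiv g) \<theta>)"
    using D(2) H by (simp flip: rat_eval_of_int_poly)
  then have "int_eval (H1 * pderiv g - [:D:]) \<theta> = 0"
    using g'0 by simp
  moreover have "g \<noteq> 0" using g n by auto
  \<comment> \<open>The identity \<open>D' (H1 g' - D) = g w\<close> plays the role of a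
    discriminant: a prime dividing both \<open>g(a0)\<close> and \<open>g'(a0)\<close> must divide
    \<open>D D'\<close>.\<close>
  ultimately obtain D' w where D': "D' > 0" "smult D' (H1 * pderiv g - [:D:]) = g * w"
    using minimal_annihilator_dvd[of g \<theta>] g min by metis
  have "D * D' \<noteq> 0" using D D' by simp
  then obtain p :: nat and a0 where p: "prime p" "n dvd p - 1" "\<not> int p dvd D * D'" "int p dvd poly g a0"
    using ex_prime_cong_1_with_root[of g "D * D'" n] g n by auto
  have "\<not> int p dvd poly (pderiv g) a0"
  proof
    assume *: "int p dvd poly (pderiv g) a0"
    have "D' * (poly H1 a0 * poly (pderiv g) a0 - D) = poly g a0 * poly w a0"
      using arg_cong[OF D'(2), of "\<lambda>P. poly P a0"] by simp
    then have "D * D' = D' * (poly H1 a0 * poly (pderiv g) a0) - poly g a0 * poly w a0"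
      by (simp add: algebra_simps)
    also have "int p dvd \<dots>" using * p(4) by simp
    finally show False using p(3) by simp
  qed
  moreover obtain r where r: "residue_primroot p r"
    using prime_primitive_root_exists[OF prime_gt_1_nat p(1)] p(1) by blast
  ultimately obtain a c where a: "poly g a = int p * c" and c: "[c = int r] (mod int p)"
    using lift_root_mod_prime_square[OF p(1,4)] by blast
  have "coprime p r" using r by (simp add: residue_primroot_def)
  then have pc: "coprime (int p) c"
    using c by (metis cong_imp_coprime cong_sym coprime_commute coprime_int_iff)
  then have "c \<noteq> 0" using p(1) by auto
  define \<delta> where "\<delta> = \<theta> - of_int a"
  have "int_eval [:- a, 1:] \<theta> = \<delta>" by (simp add: \<delta>_def)
  then have \<delta>0: "\<delta> \<noteq> 0" using min[of "[:- a, 1:]"] n by auto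
  define \<alpha> where "\<alpha> = of_nat p / \<delta>"
  have \<alpha>\<delta>: "\<alpha> * \<delta> = of_nat p" and \<alpha>0: "\<alpha> \<noteq> 0"
    using \<delta>0 p(1) prime_gt_0_nat[of p] by (simp_all add: \<alpha>_def)
  define h where "h = pcompose g [:a, 1:]"
  have h: "degree h = n" "coeff h 0 = int p * c"
    using g(1) a by (simp_all add: h_def degree_pcompose poly_pcompose flip: poly_0_coeff_0)
  have h\<delta>: "int_eval h \<delta> = 0"
    using g(3) by (simp add: h_def int_eval_pcompose \<delta>_def)
  \<comment> \<open>Since \<open>\<delta> = p / \<alpha>\<close>, the expression
    \<open>X^n h(p / X)\<close> is a polynomial vanishing at \<open>\<alpha>\<close>;
    \<open>F\<close> lists its coefficients divided by \<open>p\<close>. At \<open>j = n\<close>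
    this division uses \<open>h(0) = p c\<close> and leaves the leading coefficient
    \<open>c\<close>.\<close>
  define F where "F = (\<lambda>j. if j = n then c else coeff h (n - j) * int p ^ (n - j - 1))"
  define f where "f = (\<Sum>j\<le>n. monom (F j) j)"
  have coeff_f: "coeff f j = (if j \<le> n then F j else 0)" for j
    by (simp add: f_def coeff_sum)
  have pF: "int p * F j = coeff h (n - j) * int p ^ (n - j)" if "j \<le> n" for j
  proof (cases "j = n")
    case False
    then have "n - j = Suc (n - j - 1)" using that by simp
    then have "int p ^ (n - j) = int p * int p ^ (n - j - 1)" by (metis power_Suc)
    then show ?thesis using False by (simp add: F_def)
  qed (simp add: F_def h)
  have deg_f: "degree f = n"
  proof (rule antisym)
    show "degree f \<le> n" by (rule degree_le) (simp add: coeff_f)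
    show "n \<le> degree f" by (rule le_degree) (simp add: coeff_f F_def \<open>c \<noteq> 0\<close>)
  qed
  show ?thesis
  proof (rule that)
    show "prime p" "n dvd p - 1" "degree f = n" "residue_primroot p r" by fact+
    show "[lead_coeff f = int r] (mod int p)"
      using c by (simp add: deg_f coeff_f F_def)
    have "of_nat p * int_eval f \<alpha> = (\<Sum>j\<le>n. of_int (int p * F j) * \<alpha> ^ j)"
      by (simp add: f_def sum_distrib_left mult.assoc)
    also have "\<dots> = (\<Sum>j\<le>n. \<alpha> ^ n * (of_int (coeff h (n - j)) * \<delta> ^ (n - j)))"
    proof (intro sum.cong refl)
      fix j assume "j \<in> {..n}"
      then have j: "j \<le> n" by simp
      have "\<alpha> ^ n = \<alpha> ^ (n - j) * \<alpha> ^ j" using j by (simp flip: power_add)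
      then have "of_nat p ^ (n - j) * \<alpha> ^ j = \<alpha> ^ n * \<delta> ^ (n - j)"
        by (simp add: power_mult_distrib flip: \<alpha>\<delta>)
      then show "of_int (int p * F j) * \<alpha> ^ j = \<alpha> ^ n * (of_int (coeff h (n - j)) * \<delta> ^ (n - j))"
        unfolding pF[OF j] by (simp add: mult.assoc mult.left_commute)
    qed
    also have "\<dots> = \<alpha> ^ n * int_eval h \<delta>"
      unfolding int_eval_altdef[of h n, OF eq_refl[OF h(1)]] sum_distrib_left
      by (rule sum.reindex_bij_witness[of _ "\<lambda>i. n - i" "\<lambda>i. n - i"]) auto
    finally show "int_eval f \<alpha> = 0"
      using h\<delta> prime_gt_0_nat[OF p(1)] by simp
    show "content f = 1"
    proof -
      \<comment> \<open>The content \<open>d\<close> divides \<open>c\<close>, hence is coprime to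
        \<open>p\<close>; the powers of \<open>p\<close> can then be cancelled, and \<open>d\<close>
        divides every coefficient of \<open>h\<close>, a shift of the primitive
        \<open>g\<close>.\<close>
      define d where "d = content f"
      have dF: "d dvd F j" if "j \<le> n" for j
        using content_dvd_coeff[of f j] that by (simp add: d_def coeff_f)
      then have "d dvd c" using dF[of n] by (simp add: F_def)
      then have cop: "coprime d (int p ^ i)" for i
        using pc by (metis coprime_commute coprime_divisors coprime_power_right_iff dvd_refl)
      have "d dvd coeff h i" for i
      proof (cases "i \<le> n")
        case True
        then have "d dvd coeff h i * int p ^ i"
          using dF[of "n - i"] pF[of "n - i"] by (metis diff_diff_cancel diff_le_self dvd_mult)
        then show ?thesis using cop coprime_dvd_mult_left_iff by blast
      next
        case False
        then show ?thesis using h(1) by (simp add: coeff_eq_0)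
      qed
      then have "[:d:] dvd h" by (simp add: const_poly_dvd_iff)
      then have "is_unit d" unfolding h_def by (rule content_pcompose_shift[OF g(2)])
      then show ?thesis unfolding d_def by (rule is_unit_content_iff[THEN iffD1])
    qed
    have "\<delta> \<in> K"
      unfolding \<delta>_def \<theta>
      by (intro subring_closed(4) is_subring_Qring Qring_self subring_of_int)
    then have "\<alpha> \<in> K"
      unfolding \<alpha>_def by (intro subfield_divide[OF sub] subring_of_nat R)
    then have "Qring \<alpha> \<subseteq> K" using Qring_mono[of \<alpha> \<theta>] \<theta> by simp
    obtain B where B: "finite B" "rat_vs.span B = K"
      using K by (auto simp: number_field_def)
    have sub\<alpha>: "is_subfield (Qring \<alpha>)"
      using is_subfield_Qring[OF B(1)] \<open>Qring \<alpha> \<subseteq> K\<close> B(2) by simp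
    have "\<theta> = of_int a + of_nat p / \<alpha>"
      using \<alpha>0 \<alpha>\<delta> by (simp add: \<delta>_def field_simps)
    also have "\<dots> \<in> Qring \<alpha>"
      by (intro subring_closed(6)[OF is_subring_Qring] subfield_divide[OF sub\<alpha>] Qring_self
          subring_of_int subring_of_nat is_subring_Qring)
    finally have "K \<subseteq> Qring \<alpha>" unfolding \<theta> by (rule Qring_mono)
    with \<open>Qring \<alpha> \<subseteq> K\<close> show "K = Qring \<alpha>" by blast
  qed
qed

section \<open>A basis of the order of a generator\<close>

lemma poly_shift_cutoff: "(P :: int poly) = monom 1 k * poly_shift k P + poly_cutoff k P"
  by (simp add: poly_eq_iff coeff_monom_mult coeff_poly_shift coeff_poly_cutoff)

text \<open>Since the degree of \<open>f\<close> is \<open>[K : Q]\<close>, \<open>f\<close> is, up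
  to sign, the primitive minimal polynomial of \<open>\<alpha>\<close>.\<close>

locale primitive_generator =
  fixes K :: "'a::field_char_0 set" and \<alpha> :: 'a and f :: "int poly" and n :: nat
  assumes number_field: "number_field K" and gen: "K = Qring \<alpha>"
    and n_def: "n = field_degree K" and n_gt_1: "n > 1"
    and degree_f: "degree f = n" and content_f: "content f = 1" and root_f: "int_eval f \<alpha> = 0"
begin

lemma annihilator_degree_ge: "P \<noteq> 0 \<Longrightarrow> int_eval P \<alpha> = 0 \<Longrightarrow> n \<le> degree P"
  using degree_annihilator_ge[of "of_int_poly P" \<alpha>] n_def gen by (simp add: rat_eval_of_int_poly)

lemma f_nonzero: "f \<noteq> 0"
  using degree_f n_gt_1 by auto

text \<open>Minimality gives \<open>D T = e f\<close> with integers \<open>D\<close> and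
  \<open>e\<close>; as \<open>f\<close> is primitive, comparing contents shows that \<open>D\<close>
  divides \<open>e\<close>.\<close>

lemma annihilator_eq_smult:
  assumes "degree T \<le> n" "int_eval T \<alpha> = 0"
  obtains e where "T = smult e f"
proof -
  obtain D w where D: "D > 0" "smult D T = f * w"
    using minimal_annihilator_dvd[OF f_nonzero root_f _ assms(2)] annihilator_degree_ge degree_f by metis
  have "degree w = 0"
  proof (cases "w = 0")
    case False
    then have "degree (smult D T) = n + degree w"
      using D(2) f_nonzero degree_f by (simp add: degree_mult_eq)
    then show ?thesis using D(1) assms(1) by simp
  qed auto
  then obtain e where e: "w = [:e:]" by (meson degree_eq_zeroE)
  then have "content (smult D T) = content (smult e f)" using D(2) by simp
  then have "D * content T = \<bar>e\<bar>" using content_f D(1) by simp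
  then have "D dvd e" by (metis dvd_abs_iff dvd_triv_left)
  then obtain e' where "e = D * e'" by auto
  then have "smult D T = smult D (smult e' f)" using D(2) e by simp
  then have "T = smult e' f" using D(1) by (metis less_irrefl smult_cancel)
  then show ?thesis by (rule that)
qed

lemma adjoin_eq: "adjoin_Q \<alpha> = K"
  using adjoin_Q_eq_Qring[of \<alpha>] number_field gen by (simp add: number_field_def)

section \<open>The lattice \<open>M_module\<close> and its multiplier ring\<close>

lemma M_module_eq: "M_module \<alpha> = {int_eval P \<alpha> | P. degree P < n}"
proof (intro equalityI subsetI)
  fix u assume "u \<in> M_module \<alpha>"
  then obtain x where x: "u = (\<Sum>i<n. of_int (x i) * \<alpha> ^ i)"
    using adjoin_eq n_def by (auto simp: M_module_def)
  have "degree (\<Sum>i<n. monom (x i) i) \<le> n - 1"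
    by (intro degree_sum_le order_trans[OF degree_monom_le]) auto
  then show "u \<in> {int_eval P \<alpha> | P. degree P < n}"
    using n_gt_1 x by (auto intro!: exI[of _ "\<Sum>i<n. monom (x i) i"])
next
  fix u assume "u \<in> {int_eval P \<alpha> | P. degree P < n}"
  then obtain P where P: "u = int_eval P \<alpha>" "degree P \<le> n - 1" "degree P < n" by auto
  have "{..n - 1} = {..<n}" using n_gt_1 by auto
  then have "u = (\<Sum>i<n. of_int (coeff P i) * \<alpha> ^ i)"
    using P(1) int_eval_altdef[OF P(2)] by simp
  then show "u \<in> M_module \<alpha>"
    using adjoin_eq n_def by (auto simp: M_module_def)
qed

lemma M_module_I: "degree P < n \<Longrightarrow> int_eval P \<alpha> \<in> M_module \<alpha>"
  by (auto simp: M_module_eq)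

lemma M_module_add:
  assumes "u \<in> M_module \<alpha>" "v \<in> M_module \<alpha>"
  shows "u + v \<in> M_module \<alpha>"
proof -
  obtain P Q where "u = int_eval P \<alpha>" "degree P < n" "v = int_eval Q \<alpha>" "degree Q < n"
    using assms by (auto simp: M_module_eq)
  then show ?thesis using M_module_I[of "P + Q"] by (simp add: degree_add_less)
qed

lemma M_module_scale:
  assumes "u \<in> M_module \<alpha>"
  shows "of_int c * u \<in> M_module \<alpha>"
proof -
  obtain P where "u = int_eval P \<alpha>" "degree P < n"
    using assms by (auto simp: M_module_eq)
  then show ?thesis
    using M_module_I[of "smult c P"] le_less_trans[OF degree_smult_le] by simp
qed

lemma M_module_diff: "u \<in> M_module \<alpha> \<Longrightarrow> v \<in> M_module \<alpha> \<Longrightarrow> u - v \<in> M_module \<alpha>"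
  using M_module_add[of u "of_int (- 1) * v"] M_module_scale[of v "- 1"] by simp

lemma M_module_sum: "(\<And>i. i \<in> I \<Longrightarrow> u i \<in> M_module \<alpha>) \<Longrightarrow> sum u I \<in> M_module \<alpha>"
proof (induction I rule: infinite_finite_induct)
  case (infinite I)
  then show ?case using M_module_I[of 0] n_gt_1 by simp
next
  case empty
  then show ?case using M_module_I[of 0] n_gt_1 by simp
qed (simp add: M_module_add)

lemma Z_ring_I:
  assumes "\<xi> \<in> K" "\<And>j. j < n \<Longrightarrow> \<xi> * \<alpha> ^ j \<in> M_module \<alpha>"
  shows "\<xi> \<in> Z_ring \<alpha>"
proof -
  have "\<xi> * u \<in> M_module \<alpha>" if u: "u \<in> M_module \<alpha>" for u
  proof -
    obtain x where "u = (\<Sum>i<n. of_int (x i) * \<alpha> ^ i)"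
      using u adjoin_eq n_def by (auto simp: M_module_def)
    then have "\<xi> * u = (\<Sum>i<n. of_int (x i) * (\<xi> * \<alpha> ^ i))"
      by (simp add: sum_distrib_left mult.left_commute)
    then show ?thesis using assms(2) by (auto intro!: M_module_sum M_module_scale)
  qed
  then show ?thesis using assms(1) adjoin_eq by (simp add: Z_ring_def)
qed

lemma is_subfield_K: "is_subfield K"
  using number_field by (simp add: number_field_def)

lemmas is_subring_K = subfield_is_subring[OF is_subfield_K]

lemma generator_in_K: "\<alpha> \<in> K"
  by (simp add: gen Qring_self)

lemma is_subring_Z_ring: "is_subring (Z_ring \<alpha>)"
  unfolding is_subring_def Z_ring_def adjoin_eq
  by (auto simp: left_diff_distrib mult.assoc intro: M_module_diff subring_closed(2-4)[OF is_subring_K])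

text \<open>Dropping the \<open>n - i\<close> lowest coefficients of \<open>f\<close> gives
  \<open>a X^i + ...\<close>; up to integer constants this is the classical basis of the ring of the
  binary form attached to \<open>f\<close>. At \<open>i = 0\<close> the truncation would be the
  constant \<open>a\<close>, so 1 replaces it.\<close>

definition omega_poly :: "nat \<Rightarrow> int poly" where
  "omega_poly i = (if i = 0 then 1 else poly_shift (n - i) f)"

definition \<omega> :: "nat \<Rightarrow> 'a" where
  "\<omega> i = int_eval (omega_poly i) \<alpha>"

lemma omega_0: "\<omega> 0 = 1"
  by (simp add: \<omega>_def omega_poly_def)

lemma omega_poly_lead:
  assumes "i < n"
  shows "coeff (omega_poly i) i = (if i = 0 then 1 else lead_coeff f)"
  using assms by (simp add: omega_poly_def coeff_poly_shift degree_f)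

lemma omega_poly_lead_nonzero: "i < n \<Longrightarrow> coeff (omega_poly i) i \<noteq> 0"
  using omega_poly_lead f_nonzero by simp

lemma coeff_omega_poly_eq_0: "i < n \<Longrightarrow> i < j \<Longrightarrow> coeff (omega_poly i) j = 0"
  using degree_f by (auto simp: omega_poly_def coeff_poly_shift intro: coeff_eq_0)

lemma degree_omega_poly: "i < n \<Longrightarrow> degree (omega_poly i) = i"
  using degree_le[of i "omega_poly i"] le_degree[of "omega_poly i" i] coeff_omega_poly_eq_0
    omega_poly_lead_nonzero by (intro antisym) auto

text \<open>For \<open>i + j < n\<close> the degree is small enough. Otherwise
  \<open>f(\<alpha>) = 0\<close> rewrites \<open>\<alpha>^(n - i) * \<omega> i\<close> as minus the
  dropped low part of \<open>f\<close>, and multiplying by the rest of \<open>\<alpha>^j\<close>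
  gives degree at most \<open>j - 1\<close>.\<close>

lemma omega_in_Z_ring:
  assumes "i < n"
  shows "\<omega> i \<in> Z_ring \<alpha>"
proof (rule Z_ring_I)
  show "\<omega> i \<in> K"
    unfolding \<omega>_def by (intro subring_int_eval is_subring_K generator_in_K)
next
  fix j assume j: "j < n"
  show "\<omega> i * \<alpha> ^ j \<in> M_module \<alpha>"
  proof (cases "i + j < n")
    case True
    have "degree (omega_poly i * monom 1 j) \<le> i + j"
      by (rule order_trans[OF degree_mult_le]) (simp add: degree_omega_poly assms degree_monom_le)
    then show ?thesis
      using M_module_I[of "omega_poly i * monom 1 j"] True by (simp add: \<omega>_def)
  next
    case False
    then have i: "i \<noteq> 0" using j by auto
    define k where "k = n - i"
    have k: "k \<le> j" "0 < k" using False assms by (auto simp: k_def)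
    have "0 = int_eval (monom 1 k * poly_shift k f + poly_cutoff k f) \<alpha>"
      using root_f poly_shift_cutoff[of f k] by simp
    also have "\<dots> = \<alpha> ^ k * \<omega> i + int_eval (poly_cutoff k f) \<alpha>"
      using i by (simp add: \<omega>_def omega_poly_def k_def)
    finally have "\<alpha> ^ k * \<omega> i = - int_eval (poly_cutoff k f) \<alpha>" by (simp add: eq_neg_iff_add_eq_0)
    moreover have "\<alpha> ^ j = \<alpha> ^ k * \<alpha> ^ (j - k)" using k by (simp flip: power_add)
    moreover have "\<omega> i * (\<alpha> ^ k * \<alpha> ^ (j - k)) = \<alpha> ^ k * \<omega> i * \<alpha> ^ (j - k)" by (simp add: mult_ac)
    ultimately have "\<omega> i * \<alpha> ^ j = int_eval (- poly_cutoff k f * monom 1 (j - k)) \<alpha>"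
      by simp
    moreover have "degree (- poly_cutoff k f * monom 1 (j - k)) \<le> (k - 1) + (j - k)"
    proof (rule order_trans[OF degree_mult_le add_mono])
      show "degree (- poly_cutoff k f) \<le> k - 1"
        using k by (intro degree_le) (auto simp: coeff_poly_cutoff)
    qed (simp add: degree_monom_le)
    ultimately show ?thesis
      using M_module_I[of "- poly_cutoff k f * monom 1 (j - k)"] k j by simp
  qed
qed

definition omega_span :: "'a set" where
  "omega_span = {\<Sum>i<n. of_int (c i) * \<omega> i | c. True}"

lemma omega_span_I: "(\<Sum>i<n. of_int (c i) * \<omega> i) \<in> omega_span"
  by (auto simp: omega_span_def)

lemma omega_span_add_omega:
  assumes "u \<in> omega_span" "i < n"
  shows "u + of_int e * \<omega> i \<in> omega_span"
proof -
  obtain c where c: "u = (\<Sum>i<n. of_int (c i) * \<omega> i)" using assms(1) by (auto simp: omega_span_def)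
  have "of_int e * \<omega> i = (\<Sum>j<n. of_int (if j = i then e else 0) * \<omega> j)"
  proof -
    have "(\<Sum>j<n. of_int (if j = i then e else 0) * \<omega> j) = (\<Sum>j<n. if j = i then of_int e * \<omega> j else 0)"
      by (intro sum.cong) auto
    then show ?thesis using assms(2) by simp
  qed
  then have "u + of_int e * \<omega> i = (\<Sum>j<n. of_int (c j + (if j = i then e else 0)) * \<omega> j)"
    by (simp only: c of_int_add distrib_right sum.distrib)
  then show ?thesis by (simp only: omega_span_I)
qed

text \<open>Induction on \<open>d = degree P\<close>: multiplying by \<open>\<alpha>^(n - d)\<close>
  must stay in the lattice, which produces an annihilator of degree at most \<open>n\<close>, hence
  a multiple \<open>e f\<close>. So the leading coefficient of \<open>P\<close> is \<open>e\<close>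
  times that of \<open>f\<close>, and subtracting \<open>e * \<omega> d\<close> lowers the
  degree.\<close>

lemma Z_ring_subset_omega_span:
  "degree P < n \<Longrightarrow> int_eval P \<alpha> \<in> Z_ring \<alpha> \<Longrightarrow> int_eval P \<alpha> \<in> omega_span"
proof (induction "degree P" arbitrary: P rule: less_induct)
  case less
  define d where "d = degree P"
  have d: "d < n" using less.prems by (simp add: d_def)
  have zero: "0 \<in> omega_span"
    using omega_span_I[of "\<lambda>_. 0"] by simp
  show ?case
  proof (cases "d = 0")
    case True
    then obtain a where "P = [:a:]" unfolding d_def by (meson degree_eq_zeroE)
    then show ?thesis using omega_span_add_omega[OF zero, of 0 a] n_gt_1 by (simp add: omega_0)
  next
    case False
    have "\<alpha> ^ (n - d) \<in> M_module \<alpha>"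
      using M_module_I[of "monom 1 (n - d)"] degree_monom_le[of "1::int" "n - d"] False d by simp
    then have "int_eval P \<alpha> * \<alpha> ^ (n - d) \<in> M_module \<alpha>"
      using less.prems(2) by (simp add: Z_ring_def)
    then obtain Q where Q: "int_eval P \<alpha> * \<alpha> ^ (n - d) = int_eval Q \<alpha>" "degree Q < n"
      by (auto simp: M_module_eq)
    have "degree (P * monom 1 (n - d)) \<le> d + (n - d)"
      by (rule order_trans[OF degree_mult_le]) (simp add: d_def degree_monom_le)
    then have "degree (P * monom 1 (n - d) - Q) \<le> n"
      using Q(2) d by (intro degree_diff_le) auto
    moreover have "int_eval (P * monom 1 (n - d) - Q) \<alpha> = 0" using Q(1) by simp
    ultimately obtain e where e: "P * monom 1 (n - d) - Q = smult e f"
      using annihilator_eq_smult by blast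
    have "coeff (P * monom 1 (n - d) - Q) n = coeff P d"
      using Q(2) d by (simp add: coeff_eq_0 mult.commute[of P] coeff_monom_mult)
    then have lead: "coeff P d = e * lead_coeff f" using e degree_f by simp
    define P' where "P' = P - smult e (omega_poly d)"
    have P'0: "degree P' < d"
    proof -
      have "coeff P' d = 0" using lead omega_poly_lead[OF d] False by (simp add: P'_def)
      moreover have "degree P' \<le> d"
        unfolding P'_def using degree_omega_poly[OF d] degree_smult_le[of e "omega_poly d"]
        by (intro degree_diff_le) (auto simp: d_def)
      ultimately show ?thesis
        using False by (cases "degree P' = d") (auto simp: leading_coeff_0_iff)
    qed
    have eq: "int_eval P \<alpha> = int_eval P' \<alpha> + of_int e * \<omega> d"
      by (simp add: P'_def \<omega>_def)
    have "int_eval P \<alpha> - of_int e * \<omega> d \<in> Z_ring \<alpha>"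
      by (intro subring_closed[OF is_subring_Z_ring] subring_of_int is_subring_Z_ring omega_in_Z_ring d less.prems)
    then have "int_eval P' \<alpha> \<in> omega_span"
      using less.hyps[of P'] P'0 d eq by (simp add: d_def)
    then show ?thesis unfolding eq by (rule omega_span_add_omega[OF _ d])
  qed
qed

lemma Z_ring_eq: "Z_ring \<alpha> = omega_span"
proof
  show "omega_span \<subseteq> Z_ring \<alpha>"
    unfolding omega_span_def
    by (fast intro: subring_sum[OF is_subring_Z_ring] subring_closed(3)[OF is_subring_Z_ring]
        subring_of_int[OF is_subring_Z_ring] omega_in_Z_ring)
  show "Z_ring \<alpha> \<subseteq> omega_span"
  proof
    fix u assume u: "u \<in> Z_ring \<alpha>"
    \<comment> \<open>Because 1 lies in the lattice, the multiplier ring is contained in it, so its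
      elements are values of polynomials of degree below \<open>n\<close>.\<close>
    have "1 \<in> M_module \<alpha>" using M_module_I[of 1] n_gt_1 by simp
    then have "u * 1 \<in> M_module \<alpha>" using u unfolding Z_ring_def by blast
    then obtain P where "u = int_eval P \<alpha>" "degree P < n" by (auto simp: M_module_eq)
    then show "u \<in> omega_span" using Z_ring_subset_omega_span u by blast
  qed
qed

text \<open>The polynomials \<open>omega_poly i\<close> have degree exactly \<open>i\<close>, so the
  term of largest index with nonzero coefficient cannot cancel, while no nonzero polynomial of
  degree below \<open>n\<close> annihilates \<open>\<alpha>\<close>.\<close>

lemma omega_independent:
  assumes "(\<Sum>i<n. of_int (c i) * \<omega> i) = 0" "i < n"
  shows "c i = 0"
proof (rule ccontr)
  assume "c i \<noteq> 0"
  define m where "m = Max {j. j < n \<and> c j \<noteq> 0}"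
  have fin: "finite {j. j < n \<and> c j \<noteq> 0}" by simp
  have m: "m < n" "c m \<noteq> 0"
    using Max_in[OF fin] \<open>c i \<noteq> 0\<close> assms(2) unfolding m_def by blast+
  have above: "c j = 0" if "m < j" "j < n" for j
  proof (rule ccontr)
    assume "c j \<noteq> 0"
    then have "j \<le> m" unfolding m_def using that(2) by (intro Max_ge[OF fin]) simp
    then show False using that(1) by simp
  qed
  define P where "P = (\<Sum>i<n. smult (c i) (omega_poly i))"
  have "degree P \<le> n - 1"
    unfolding P_def using degree_omega_poly
    by (intro degree_sum_le order_trans[OF degree_smult_le]) auto
  moreover have "int_eval P \<alpha> = 0" using assms(1) by (simp add: P_def \<omega>_def)
  ultimately have "P = 0" using annihilator_degree_ge[of P] n_gt_1 by fastforce
  moreover have "coeff P m = (\<Sum>i\<in>{m}. c i * coeff (omega_poly i) m)"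
    unfolding P_def coeff_sum coeff_smult
  proof (rule sum.mono_neutral_right)
    show "\<forall>i\<in>{..<n} - {m}. c i * coeff (omega_poly i) m = 0"
    proof
      fix i assume "i \<in> {..<n} - {m}"
      then consider "i < n" "i < m" | "i < n" "m < i" by fastforce
      then show "c i * coeff (omega_poly i) m = 0"
        by cases (simp_all add: above coeff_omega_poly_eq_0)
    qed
  qed (use m in auto)
  ultimately show False using m omega_poly_lead_nonzero[OF m(1)] by simp
qed

lemma omega_inj: "inj_on \<omega> {..<n}"
proof (rule inj_onI, rule ccontr)
  fix i j assume ij: "i \<in> {..<n}" "j \<in> {..<n}" "\<omega> i = \<omega> j" "i \<noteq> j"
  have "(\<Sum>k<n. of_int ((if k = i then 1 else 0) - (if k = j then 1 else 0)) * \<omega> k) =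
     (\<Sum>k<n. (if k = i then \<omega> k else 0) - (if k = j then \<omega> k else 0))"
    by (intro sum.cong) auto
  also have "\<dots> = 0" using ij by (simp add: sum_subtractf)
  finally have "(if i = i then 1 else 0) - (if i = j then 1 else 0 :: int) = 0"
    by (rule omega_independent) (use ij in simp)
  then show False using ij(4) by simp
qed

lemma is_order_Z_ring: "is_order K (Z_ring \<alpha>)"
proof -
  let ?B = "\<omega> ` {..<n}"
  have "int_mod.independent ?B"
  proof
    assume "int_mod.dependent ?B"
    then obtain u where u: "\<exists>v\<in>?B. u v \<noteq> 0" "(\<Sum>i<n. of_int (u (\<omega> i)) * \<omega> i) = 0"
      unfolding int_mod.dependent_finite[OF finite_imageI[OF finite_lessThan]]
        sum.reindex[OF omega_inj] o_def by blast
    then show False using omega_independent[of "\<lambda>i. u (\<omega> i)"] by blast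
  qed
  moreover have "int_mod.span ?B = Z_ring \<alpha>"
    unfolding int_mod.span_finite[OF finite_imageI[OF finite_lessThan]] Z_ring_eq
      sum.reindex[OF omega_inj] o_def omega_span_def
  proof (intro equalityI subsetI)
    fix u assume "u \<in> {\<Sum>i<n. of_int (c i) * \<omega> i | c. True}"
    then obtain c where "u = (\<Sum>i<n. of_int (c i) * \<omega> i)" by blast
    also have "\<dots> = (\<Sum>i<n. of_int (c (inv_into {..<n} \<omega> (\<omega> i))) * \<omega> i)"
      by (intro sum.cong refl) (simp add: inv_into_f_f[OF omega_inj])
    finally show "u \<in> range (\<lambda>u. \<Sum>i<n. of_int (u (\<omega> i)) * \<omega> i)"
      by (rule range_eqI[of u "\<lambda>u. \<Sum>i<n. of_int (u (\<omega> i)) * \<omega> i" "\<lambda>v. c (inv_into {..<n} \<omega> v)"])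
  qed auto
  moreover have "card ?B = field_degree K"
    using card_image[OF omega_inj] n_def by simp
  moreover have "Z_ring \<alpha> \<subseteq> K" by (auto simp: Z_ring_def adjoin_eq)
  ultimately show ?thesis
    unfolding is_order_def using is_subring_Z_ring by blast
qed

lemma rationally_monogenic_Z_ring: "rationally_monogenic_order K (Z_ring \<alpha>)"
  using is_order_Z_ring adjoin_eq by (auto simp: rationally_monogenic_order_def)

end

section \<open>Triangular matrices and power bases\<close>

text \<open>Replacing the entries below the diagonal by 0 changes each term of the Leibniz formula
  only by a multiple of \<open>p\<close>.\<close>

lemma det_cong_triangular:
  fixes A :: "nat \<Rightarrow> nat \<Rightarrow> int"
  assumes "\<And>i j. i < n \<Longrightarrow> j < i \<Longrightarrow> p dvd A i j"
  shows "[det (mat n n (\<lambda>(i, j). A i j)) = (\<Prod>i<n. A i i)] (mod p)"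
proof -
  let ?T = "mat n n (\<lambda>(i, j). if j < i then 0 else A i j)"
  have "[det (mat n n (\<lambda>(i, j). A i j)) = det ?T] (mod p)"
    unfolding det_def'[OF mat_carrier]
  proof (intro cong_sum cong_mult cong_prod cong_refl)
    fix \<pi> i assume "\<pi> \<in> {\<pi>. \<pi> permutes {0..<n}}" "i \<in> {0..<n}"
    then have "i < n" "\<pi> i < n" using permutes_in_image[of \<pi> "{0..<n}" i] by auto
    then show "[mat n n (\<lambda>(i, j). A i j) $$ (i, \<pi> i) = ?T $$ (i, \<pi> i)] (mod p)"
      using assms[of i "\<pi> i"] by (simp add: cong_0_iff)
  qed
  also have "det ?T = (\<Prod>i<n. A i i)"
  proof -
    have "upper_triangular ?T" by (auto simp: upper_triangular_def)
    then have "det ?T = prod_list (diag_mat ?T)" by (rule det_upper_triangular[OF _ mat_carrier])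
    also have "\<dots> = (\<Prod>i<n. A i i)"
      by (simp add: diag_mat_def prod.list_conv_set_nth atLeast0LessThan)
    finally show ?thesis .
  qed
  finally show ?thesis .
qed

lemma int_eval_in_power_span:
  fixes \<gamma> :: "'a::comm_ring_1"
  assumes "degree \<chi> = n" "coeff \<chi> n = 1" "int_eval \<chi> \<gamma> = 0" "n > 0"
  shows "\<exists>c. int_eval P \<gamma> = (\<Sum>j<n. of_int (c j) * \<gamma> ^ j)"
proof (induction P)
  case 0
  show ?case by (rule exI[of _ "\<lambda>_. 0"]) simp
next
  case (pCons a P)
  then obtain c where c: "int_eval P \<gamma> = (\<Sum>j<n. of_int (c j) * \<gamma> ^ j)" by blast
  obtain m where m: "n = Suc m" using assms(4) by (cases n) auto
  have "0 = (\<Sum>j\<le>n. of_int (coeff \<chi> j) * \<gamma> ^ j)"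
    using int_eval_altdef[of \<chi> n \<gamma>] assms by simp
  also have "\<dots> = (\<Sum>j<n. of_int (coeff \<chi> j) * \<gamma> ^ j) + \<gamma> ^ n"
    using assms(2) by (simp flip: lessThan_Suc_atMost)
  finally have top: "\<gamma> ^ n = - (\<Sum>j<n. of_int (coeff \<chi> j) * \<gamma> ^ j)"
    by (simp add: eq_neg_iff_add_eq_0 add.commute)
  \<comment> \<open>Horner step: coefficients move up by one, and the overflow
    \<open>c m * \<gamma> ^ n\<close> is removed with the monic relation
    \<open>\<chi>\<close>.\<close>
  define d where "d = (\<lambda>j. (case j of 0 \<Rightarrow> a | Suc i \<Rightarrow> c i) - c m * coeff \<chi> j)"
  have "int_eval (pCons a P) \<gamma> = of_int a + (\<Sum>j<Suc m. of_int (c j) * \<gamma> ^ Suc j)"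
    by (simp add: c m sum_distrib_left algebra_simps)
  also have "\<dots> = (of_int a + (\<Sum>j<m. of_int (c j) * \<gamma> ^ Suc j)) + of_int (c m) * \<gamma> ^ n"
    by (simp add: m)
  also have "of_int a + (\<Sum>j<m. of_int (c j) * \<gamma> ^ Suc j) =
      (\<Sum>j<n. of_int (case j of 0 \<Rightarrow> a | Suc i \<Rightarrow> c i) * \<gamma> ^ j)"
    unfolding m sum.lessThan_Suc_shift by simp
  also have "\<dots> + of_int (c m) * \<gamma> ^ n = (\<Sum>j<n. of_int (d j) * \<gamma> ^ j)"
    unfolding top d_def by (simp add: sum_subtractf sum_distrib_left algebra_simps)
  finally show ?case by blast
qed

text \<open>The powers of \<open>\<gamma>\<close> form another basis of the lattice, because the characteristic polynomial of
  the multiplication by \<open>\<gamma>\<close> is a monic relation of degree \<open>n\<close> for \<open>\<gamma>\<close>.\<close>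

lemma det_power_basis_square:
  fixes w :: "nat \<Rightarrow> 'a::field_char_0"
  assumes indep: "\<And>c i. (\<Sum>i<n. of_int (c i) * w i) = 0 \<Longrightarrow> i < n \<Longrightarrow> c i = (0::int)"
    and n: "n > 0"
    and mult: "\<And>j. j < n \<Longrightarrow> \<exists>c. \<gamma> * w j = (\<Sum>l<n. of_int (c l) * w l)"
    and gen: "\<And>j. j < n \<Longrightarrow> \<exists>P. w j = int_eval P \<gamma>"
    and A: "\<And>i. i < n \<Longrightarrow> \<gamma> ^ i = (\<Sum>l<n. of_int (A i l) * w l)"
  shows "(det (mat n n (\<lambda>(i, l). A i l)))\<^sup>2 = (1::int)"
proof -
  obtain C where C: "\<And>j. j < n \<Longrightarrow> \<gamma> * w j = (\<Sum>l<n. of_int (C j l) * w l)"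
    using mult by metis
  define M where "M = mat n n (\<lambda>(i, l). C i l)"
  have M: "M \<in> carrier_mat n n" by (simp add: M_def)
  have "w 0 \<noteq> 0"
  proof
    assume "w 0 = 0"
    then have "(\<Sum>i<n. of_int (if i = 0 then 1 else 0 :: int) * w i) = 0"
      by (intro sum.neutral) auto
    then show False using indep[of "\<lambda>i. if i = 0 then 1 else 0" 0] n by simp
  qed
  \<comment> \<open>The vector of the \<open>w j\<close> is an eigenvector, with eigenvalue
    \<open>\<gamma>\<close>, of the integer matrix of multiplication by
    \<open>\<gamma>\<close>.\<close>
  have "eigenvalue (map_mat of_int M) \<gamma>"
    unfolding eigenvalue_def eigenvector_def
  proof (intro exI[of _ "vec n w"] conjI)
    have "vec n w $ 0 \<noteq> 0\<^sub>v n $ 0" using n \<open>w 0 \<noteq> 0\<close> by simp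
    then show "vec n w \<noteq> 0\<^sub>v (dim_row (map_mat of_int M))" using M by (metis carrier_matD(1) index_map_mat(2))
    show "map_mat of_int M *\<^sub>v vec n w = \<gamma> \<cdot>\<^sub>v vec n w"
      using C by (intro eq_vecI) (auto simp: M_def scalar_prod_def atLeast0LessThan)
  qed (use M in auto)
  then have "poly (char_poly (map_mat of_int M)) \<gamma> = 0"
    using eigenvalue_root_char_poly[of "map_mat of_int M" n \<gamma>] M by simp
  moreover have "char_poly (map_mat of_int M) = (of_int_poly (char_poly M) :: 'a poly)"
    by (rule of_int_hom.char_poly_hom[OF M])
  ultimately have \<chi>: "int_eval (char_poly M) \<gamma> = 0"
    by (simp add: int_eval_def)
  have "\<exists>c. w j = (\<Sum>i<n. of_int (c i) * \<gamma> ^ i)" if "j < n" for j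
    using gen[OF that] int_eval_in_power_span[of "char_poly M" n \<gamma>, OF _ _ \<chi> n] degree_monic_char_poly[OF M]
    by auto
  then obtain B where B: "\<And>j. j < n \<Longrightarrow> w j = (\<Sum>i<n. of_int (B j i) * \<gamma> ^ i)" by metis
  let ?A = "mat n n (\<lambda>(i, l). A i l)" and ?B = "mat n n (\<lambda>(i, l). B i l)"
  have "?B * ?A = 1\<^sub>m n"
  proof (rule eq_matI)
    fix j l assume "j < dim_row (1\<^sub>m n :: int mat)" "l < dim_col (1\<^sub>m n :: int mat)"
    then have j: "j < n" and l: "l < n" by auto
    have "(\<Sum>i<n. of_int (B j i) * \<gamma> ^ i) = (\<Sum>i<n. \<Sum>l<n. of_int (B j i * A i l) * w l)"
    proof (intro sum.cong refl)
      fix i assume "i \<in> {..<n}"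
      then have "i < n" by simp
      show "of_int (B j i) * \<gamma> ^ i = (\<Sum>l<n. of_int (B j i * A i l) * w l)"
        by (simp only: A[OF \<open>i < n\<close>] sum_distrib_left of_int_mult mult.assoc)
    qed
    also have "\<dots> = (\<Sum>l<n. of_int (\<Sum>i<n. B j i * A i l) * w l)"
      by (subst sum.swap) (simp only: sum_distrib_right of_int_sum)
    finally have "w j = (\<Sum>l<n. of_int (\<Sum>i<n. B j i * A i l) * w l)" using B[OF j] by simp
    moreover have "w j = (\<Sum>l<n. if l = j then w l else 0)" using j by simp
    moreover have "(\<Sum>l<n. if l = j then w l else 0) = (\<Sum>l<n. of_int (if l = j then 1 else 0) * w l)"
      by (intro sum.cong) auto
    ultimately have "(\<Sum>l<n. of_int ((\<Sum>i<n. B j i * A i l) - (if l = j then 1 else 0)) * w l) = 0"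
      by (simp only: of_int_diff left_diff_distrib sum_subtractf) (metis diff_self)
    from indep[OF this l] have "(\<Sum>i<n. B j i * A i l) = (if l = j then 1 else 0)" by simp
    then show "(?B * ?A) $$ (j, l) = 1\<^sub>m n $$ (j, l)"
      using j l by (auto simp: scalar_prod_def atLeast0LessThan)
  qed auto
  then have "det ?B * det ?A = 1"
    using det_mult[of ?B n ?A] by simp
  then have "det ?A dvd 1" by (intro dvdI[of _ _ "det ?B"]) (simp add: mult.commute)
  then have "\<bar>det ?A\<bar> = 1" by simp
  then have "\<bar>det ?A\<bar>\<^sup>2 = 1" by simp
  then show ?thesis by (simp only: power2_abs)
qed

text \<open>Squaring avoids halving the exponents \<open>n (n - 1) / 2\<close> and
  \<open>(n - 1) (n - 2) / 2\<close>, and matches the squared determinant, whose sign is unknown. At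
  \<open>i = 0\<close> the truncated \<open>i - 1\<close> is 0.\<close>

lemma prod_triangular_exponents:
  "(\<Prod>i<n. x ^ i * a ^ (i - 1))\<^sup>2 = (x :: 'a::comm_monoid_mult) ^ (n * (n - 1)) * a ^ ((n - 1) * (n - 2))"
proof (induction n)
  case (Suc m)
  have e: "m * (m - 1) + 2 * m = Suc m * m"
    by (cases m) auto
  have e': "(m - 1) * (m - 2) + 2 * (m - 1) = m * (m - 1)"
    by (cases m; cases "m - 1") (auto simp: algebra_simps)
  have "(\<Prod>i<Suc m. x ^ i * a ^ (i - 1))\<^sup>2 =
      (x ^ (m * (m - 1)) * a ^ ((m - 1) * (m - 2))) * ((x ^ m)\<^sup>2 * (a ^ (m - 1))\<^sup>2)"
    using Suc by (simp add: power_mult_distrib mult_ac)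
  also have "\<dots> = x ^ (m * (m - 1) + 2 * m) * a ^ ((m - 1) * (m - 2) + 2 * (m - 1))"
    by (simp add: power_add mult_ac flip: power_mult)
  finally show ?case unfolding e e' by simp
qed simp

text \<open>Raising the congruence to the power \<open>e = (p - 1) / n\<close> kills the factor in
  \<open>x\<close> by Fermat. Then the order \<open>n e\<close> of \<open>r\<close> divides
  \<open>(n - 1) (n - 2) e\<close>, so \<open>n\<close> divides \<open>(n - 1) (n - 2)\<close>,
  which is 2 modulo \<open>n\<close>.\<close>

lemma primroot_power_not_cong:
  fixes x a :: int
  assumes p: "prime p" "n dvd p - 1" and n: "n \<ge> 3"
    and r: "residue_primroot p r" "[a = int r] (mod int p)"
    and cong: "[x ^ (n * (n - 1)) * a ^ ((n - 1) * (n - 2)) = 1] (mod int p)"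
  shows False
proof -
  define y where "y = nat (x mod int p)"
  have y: "[int y = x] (mod int p)"
    using prime_gt_0_nat[OF p(1)] by (simp add: y_def cong_def)
  have "[int (y ^ (n * (n - 1)) * r ^ ((n - 1) * (n - 2))) = x ^ (n * (n - 1)) * a ^ ((n - 1) * (n - 2))] (mod int p)"
    unfolding of_nat_mult of_nat_power by (intro cong_mult cong_pow y cong_sym[OF r(2)])
  also note cong
  finally have "[int (y ^ (n * (n - 1)) * r ^ ((n - 1) * (n - 2))) = int 1] (mod int p)" by simp
  then have yr: "[y ^ (n * (n - 1)) * r ^ ((n - 1) * (n - 2)) = 1] (mod p)"
    by (simp only: cong_int_iff)
  have "\<not> p dvd y"
  proof
    assume "p dvd y"
    moreover have "y dvd y ^ (n * (n - 1))" using n by (intro dvd_power) simp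
    ultimately have "p dvd y ^ (n * (n - 1)) * r ^ ((n - 1) * (n - 2))"
      by (intro dvd_mult2) (rule dvd_trans)
    then have "p dvd 1" using cong_dvd_iff[OF yr] by simp
    then show False using p(1) not_prime_unit by blast
  qed
  obtain e where e: "p - 1 = n * e" using p(2) by auto
  have "p - 1 > 0" using prime_gt_1_nat[OF p(1)] by simp
  then have "e > 0" using e by (auto intro: Nat.gr0I)
  have "[(y ^ (n * (n - 1)) * r ^ ((n - 1) * (n - 2))) ^ e = 1 ^ e] (mod p)"
    by (rule cong_pow[OF yr])
  also have "(y ^ (n * (n - 1)) * r ^ ((n - 1) * (n - 2))) ^ e =
      (y ^ (p - 1)) ^ (n - 1) * r ^ ((n - 1) * (n - 2) * e)"
    unfolding e by (simp add: power_mult_distrib mult_ac flip: power_mult)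
  finally have *: "[(y ^ (p - 1)) ^ (n - 1) * r ^ ((n - 1) * (n - 2) * e) = 1] (mod p)" by simp
  have "[(y ^ (p - 1)) ^ (n - 1) * r ^ ((n - 1) * (n - 2) * e) = 1 ^ (n - 1) * r ^ ((n - 1) * (n - 2) * e)] (mod p)"
    by (intro cong_mult cong_pow cong_refl fermat_theorem p(1) \<open>\<not> p dvd y\<close>)
  then have "[r ^ ((n - 1) * (n - 2) * e) = 1] (mod p)"
    using cong_trans[OF cong_sym *] by simp
  then have "ord p r dvd (n - 1) * (n - 2) * e" by (simp only: ord_divides)
  moreover have "ord p r = n * e"
    using r(1) p(1) e by (simp add: residue_primroot_def totient_prime)
  ultimately have "n dvd (n - 1) * (n - 2)" using \<open>e > 0\<close> by simp
  moreover have "(n - 1) * (n - 2) + n * 3 = n * n + 2"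
  proof -
    obtain k where "n = k + 3" using n le_Suc_ex by (metis add.commute)
    then show ?thesis by (simp add: algebra_simps)
  qed
  ultimately have "n dvd n * n + 2"
    by (metis dvd_add dvd_triv_left)
  then have "n dvd 2" using dvd_add_right_iff[of n "n * n" 2] by simp
  then show False using n by (auto dest: dvd_imp_le)
qed

section \<open>Scaled generators\<close>

lemma adjoin_Z_subset: "adjoin_Z \<beta> \<subseteq> {int_eval P \<beta> | P. True}"
  unfolding adjoin_Z_def
proof (rule hull_minimal)
  have "\<exists>P. \<beta> = int_eval P \<beta>" by (rule exI[of _ "[:0, 1:]"]) simp
  then show "{\<beta>} \<subseteq> {int_eval P \<beta> | P. True}" by auto
  have "\<exists>P. 1 = int_eval P \<beta>" by (rule exI[of _ 1]) simp
  moreover have "\<exists>R. int_eval P \<beta> - int_eval Q \<beta> = int_eval R \<beta>" for P Q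
    by (rule exI[of _ "P - Q"]) simp
  moreover have "\<exists>R. int_eval P \<beta> * int_eval Q \<beta> = int_eval R \<beta>" for P Q
    by (rule exI[of _ "P * Q"]) simp
  ultimately show "is_subring {int_eval P \<beta> | P. True}"
    by (auto simp: is_subring_def)
qed

lemma adjoin_Z_self: "\<beta> \<in> adjoin_Z \<beta>"
  unfolding adjoin_Z_def by (rule hull_inc) simp

context primitive_generator
begin

text \<open>This is \<open>q^n f(X / q)\<close>, which has the root
  \<open>q \<alpha>\<close>.\<close>

definition scaled_poly :: "int \<Rightarrow> int poly" where
  "scaled_poly q = (\<Sum>l\<le>n. monom (coeff f l * q ^ (n - l)) l)"

lemma coeff_scaled_poly: "coeff (scaled_poly q) l = coeff f l * q ^ (n - l)"
  using degree_f by (auto simp: scaled_poly_def coeff_sum coeff_eq_0)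

lemma coeff_f_eq_0: "n < l \<Longrightarrow> coeff f l = 0"
  using degree_f by (simp add: coeff_eq_0)

text \<open>Source of the factors \<open>q ^ i\<close> in the basis of the scaled order; the case
  \<open>i = n\<close> yields the root \<open>q \<alpha>\<close> of
  \<open>scaled_poly q\<close>.\<close>

lemma int_eval_poly_shift_scaled:
  assumes "i \<le> n"
  shows "int_eval (poly_shift (n - i) (scaled_poly q)) (of_int q * \<alpha>) =
    of_int (q ^ i) * int_eval (poly_shift (n - i) f) \<alpha>"
proof -
  have deg: "degree (poly_shift (n - i) (scaled_poly q)) \<le> i" "degree (poly_shift (n - i) f) \<le> i"
    using assms
    by (auto intro!: degree_le simp: coeff_poly_shift coeff_scaled_poly coeff_f_eq_0)
  show ?thesis
    unfolding int_eval_altdef[OF deg(1)] int_eval_altdef[OF deg(2)] sum_distrib_left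
  proof (intro sum.cong refl)
    fix l assume "l \<in> {..i}"
    then have l: "l \<le> i" by simp
    have "n - (l + (n - i)) = i - l" using l assms by simp
    moreover have "q ^ i = q ^ (i - l) * q ^ l" using l by (simp flip: power_add)
    ultimately show "of_int (coeff (poly_shift (n - i) (scaled_poly q)) l) * (of_int q * \<alpha>) ^ l =
        of_int (q ^ i) * (of_int (coeff (poly_shift (n - i) f) l) * \<alpha> ^ l)"
      by (simp add: coeff_poly_shift coeff_scaled_poly power_mult_distrib mult_ac)
  qed
qed

lemma scaled_generator:
  assumes q: "q \<noteq> 0" "coprime q (lead_coeff f)"
  shows "primitive_generator K (of_int q * \<alpha>) (scaled_poly q) n"
proof
  show "number_field K" "n = field_degree K" "n > 1" by (fact number_field n_def n_gt_1)+
  show "K = Qring (of_int q * \<alpha>)"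
    unfolding gen
  proof
    have "of_rat (of_int q) * \<alpha> \<in> Qring \<alpha>"
      by (intro subring_closed(3)[OF is_subring_Qring] Qring_of_rat Qring_self)
    then show "Qring (of_int q * \<alpha>) \<subseteq> Qring \<alpha>" by (intro Qring_mono) simp
    have "of_rat (1 / of_int q) * (of_int q * \<alpha>) \<in> Qring (of_int q * \<alpha>)"
      by (intro subring_closed(3)[OF is_subring_Qring] Qring_of_rat Qring_self)
    moreover have "of_rat (1 / of_int q) * (of_int q * \<alpha>) = \<alpha>"
      using q(1) by (simp add: of_rat_divide)
    ultimately show "Qring \<alpha> \<subseteq> Qring (of_int q * \<alpha>)" by (intro Qring_mono) simp
  qed
  show "degree (scaled_poly q) = n"
    using degree_f f_nonzero by (intro antisym degree_le le_degree) (auto simp: coeff_scaled_poly coeff_eq_0)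
  show "int_eval (scaled_poly q) (of_int q * \<alpha>) = 0"
    using int_eval_poly_shift_scaled[of n q] root_f by simp
  show "content (scaled_poly q) = 1"
  proof -
    \<comment> \<open>The content divides the leading coefficient, hence is coprime to
      \<open>q\<close>, and the powers of \<open>q\<close> can be cancelled.\<close>
    define d where "d = content (scaled_poly q)"
    have d: "d dvd coeff f l * q ^ (n - l)" for l
      using content_dvd_coeff[of "scaled_poly q" l] by (simp add: d_def coeff_scaled_poly)
    have "d dvd lead_coeff f" using d[of n] degree_f by simp
    then have "coprime d q" using q(2) by (meson coprime_commute coprime_divisors dvd_refl)
    then have "coprime d (q ^ i)" for i by simp
    then have "d dvd coeff f l" for l using d[of l] coprime_dvd_mult_left_iff by blast
    then have "[:d:] dvd f" by (simp add: const_poly_dvd_iff)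
    then have "d dvd 1" using content_f by (simp add: const_poly_dvd_iff_dvd_content)
    then show ?thesis unfolding d_def by (rule is_unit_content_iff[THEN iffD1])
  qed
qed

lemma Z_ring_scaled:
  assumes "q \<noteq> 0" "coprime q (lead_coeff f)"
  shows "Z_ring (of_int q * \<alpha>) = {\<Sum>i<n. of_int (c i) * (of_int (q ^ i) * \<omega> i) | c. True}"
proof -
  interpret s: primitive_generator K "of_int q * \<alpha>" "scaled_poly q" n
    by (rule scaled_generator[OF assms])
  have "s.\<omega> i = of_int (q ^ i) * \<omega> i" if "i < n" for i
    using that int_eval_poly_shift_scaled[of i q]
    by (simp add: s.\<omega>_def s.omega_poly_def \<omega>_def omega_poly_def)
  then have "(\<Sum>i<n. of_int (c i) * s.\<omega> i) = (\<Sum>i<n. of_int (c i) * (of_int (q ^ i) * \<omega> i))" for c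
    by (intro sum.cong refl) simp
  then show ?thesis
    unfolding s.Z_ring_eq s.omega_span_def by simp
qed

lemma scaled_omega_independent:
  assumes "q \<noteq> 0" "(\<Sum>i<n. of_int (c i) * (of_int (q ^ i) * \<omega> i)) = 0" "i < n"
  shows "c i = 0"
  using omega_independent[of "\<lambda>i. c i * q ^ i" i] assms by (simp add: of_int_mult flip: mult.assoc)

text \<open>The coefficients at \<open>\<omega> 1\<close> of the elements of
  \<open>Z_ring (Q \<alpha>)\<close> are multiples of \<open>Q\<close>, and
  \<open>q * \<omega> 1\<close> is an element of \<open>Z_ring (q \<alpha>)\<close>.\<close>

lemma Z_ring_scaled_inj:
  assumes "q \<noteq> 0" "coprime q (lead_coeff f)" "Q \<noteq> 0" "coprime Q (lead_coeff f)"
    and "Z_ring (of_int q * \<alpha>) \<subseteq> Z_ring (of_int Q * \<alpha>)"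
  shows "Q dvd q"
proof -
  have 1: "1 < n" by (rule n_gt_1)
  have "(\<Sum>i<n. of_int (if i = 1 then 1 else 0) * (of_int (q ^ i) * \<omega> i)) \<in> Z_ring (of_int q * \<alpha>)"
    unfolding Z_ring_scaled[OF assms(1,2)]
    by (intro CollectI exI[of _ "\<lambda>i. if i = 1 then 1 else 0"] conjI refl TrueI)
  also have "(\<Sum>i<n. of_int (if i = 1 then 1 else 0) * (of_int (q ^ i) * \<omega> i)) =
      (\<Sum>i<n. of_int (if i = 1 then q else 0) * \<omega> i)"
    by (intro sum.cong) auto
  finally obtain c where c: "(\<Sum>i<n. of_int (if i = 1 then q else 0) * \<omega> i) =
      (\<Sum>i<n. of_int (c i) * (of_int (Q ^ i) * \<omega> i))"
    using assms(5) Z_ring_scaled[OF assms(3,4)] by auto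
  have "(\<Sum>i<n. of_int ((if i = 1 then q else 0) - c i * Q ^ i) * \<omega> i) = 0"
    using c by (simp only: of_int_diff of_int_mult left_diff_distrib sum_subtractf mult.assoc) simp
  from omega_independent[OF this 1] have "q = c 1 * Q" by simp
  then show ?thesis by simp
qed

end

section \<open>The scaled order modulo a divisor \<open>p\<close> of \<open>q\<close>\<close>

locale scaled_primitive_generator = primitive_generator +
  fixes q p :: int
  assumes q_nonzero: "q \<noteq> 0" and coprime_q: "coprime q (lead_coeff f)"
    and p_dvd_q: "p dvd q"
begin

definition w :: "nat \<Rightarrow> 'a" where
  "w i = of_int (q ^ i) * \<omega> i"

abbreviation R :: "'a set" where
  "R \<equiv> Z_ring (of_int q * \<alpha>)"

abbreviation a0 :: int where
  "a0 \<equiv> lead_coeff f"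

text \<open>\<open>T i\<close> is the sum of \<open>p R\<close> and the span of \<open>w i, \<dots>, w (n - 1)\<close>; in particular \<open>T n = p R\<close>.\<close>

definition T :: "nat \<Rightarrow> 'a set" where
  "T i = {\<Sum>l<n. of_int (c l) * w l | c. \<forall>l<i. p dvd c l}"

lemma R_eq: "R = {\<Sum>i<n. of_int (c i) * w i | c. True}"
  using Z_ring_scaled[OF q_nonzero coprime_q] by (simp add: w_def)

lemma is_subring_R: "is_subring R"
  by (rule primitive_generator.is_subring_Z_ring[OF scaled_generator[OF q_nonzero coprime_q]])

lemma w_independent: "(\<Sum>i<n. of_int (c i) * w i) = 0 \<Longrightarrow> i < n \<Longrightarrow> c i = 0"
  using scaled_omega_independent[OF q_nonzero] by (simp add: w_def)

lemma T_I: "(\<And>l. l < i \<Longrightarrow> p dvd c l) \<Longrightarrow> (\<Sum>l<n. of_int (c l) * w l) \<in> T i"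
  by (auto simp: T_def)

lemma T_add:
  assumes "u \<in> T i" "v \<in> T i"
  shows "u + v \<in> T i"
proof -
  obtain c d where "u = (\<Sum>l<n. of_int (c l) * w l)" "\<forall>l<i. p dvd c l"
      "v = (\<Sum>l<n. of_int (d l) * w l)" "\<forall>l<i. p dvd d l"
    using assms by (auto simp: T_def)
  then show ?thesis
    using T_I[of i "\<lambda>l. c l + d l"] by (simp only: of_int_add distrib_right sum.distrib dvd_add)
qed

lemma T_scale:
  assumes "u \<in> T i"
  shows "of_int k * u \<in> T i"
proof -
  obtain c where "u = (\<Sum>l<n. of_int (c l) * w l)" "\<forall>l<i. p dvd c l"
    using assms by (auto simp: T_def)
  then show ?thesis
    using T_I[of i "\<lambda>l. k * c l"] by (simp only: sum_distrib_left of_int_mult mult.assoc dvd_mult)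
qed

lemma T_diff: "u \<in> T i \<Longrightarrow> v \<in> T i \<Longrightarrow> u - v \<in> T i"
  using T_add[of u i "of_int (- 1) * v"] T_scale[of v i "- 1"] by simp

lemma zero_in_T: "0 \<in> T i"
  using T_I[of i "\<lambda>_. 0"] by simp

lemma T_sum: "(\<And>j. j \<in> J \<Longrightarrow> u j \<in> T i) \<Longrightarrow> sum u J \<in> T i"
  by (induction J rule: infinite_finite_induct) (auto intro: T_add zero_in_T)

lemma T_n_subset: "T n \<subseteq> T i"
proof
  fix u assume "u \<in> T n"
  then obtain c where c: "u = (\<Sum>l<n. of_int (c l) * w l)" "\<forall>l<n. p dvd c l"
    by (auto simp: T_def)
  \<comment> \<open>Coefficients of index at least \<open>n\<close> do not enter the sum but are
    constrained in \<open>T i\<close> when \<open>i > n\<close>; they are replaced by 0.\<close>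
  then have "u = (\<Sum>l<n. of_int (if l < n then c l else 0) * w l)"
    by (auto intro!: sum.cong)
  also have "\<dots> \<in> T i" using c(2) by (intro T_I) auto
  finally show "u \<in> T i" .
qed

lemma T_subset_R: "T i \<subseteq> R"
  by (auto simp: T_def R_eq)

lemma w_in_T:
  assumes "l < n" "i \<le> l"
  shows "w l \<in> T i"
proof -
  have "w l = (\<Sum>j<n. if j = l then w j else 0)" using assms by simp
  also have "\<dots> = (\<Sum>j<n. of_int (if j = l then 1 else 0) * w j)"
    by (intro sum.cong) auto
  also have "\<dots> \<in> T i" using assms by (intro T_I) auto
  finally show ?thesis .
qed

lemma T_n_iff: "u \<in> T n \<longleftrightarrow> (\<exists>v\<in>R. u = of_int p * v)"
proof
  assume "u \<in> T n"
  then obtain c where c: "u = (\<Sum>l<n. of_int (c l) * w l)" "\<forall>l<n. p dvd c l"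
    by (auto simp: T_def)
  then obtain d where d: "\<forall>l<n. c l = p * d l" unfolding dvd_def by metis
  have "u = of_int p * (\<Sum>l<n. of_int (d l) * w l)"
    unfolding c(1) sum_distrib_left using d by (intro sum.cong) auto
  then show "\<exists>v\<in>R. u = of_int p * v" unfolding R_eq by blast
next
  assume "\<exists>v\<in>R. u = of_int p * v"
  then obtain c where "u = of_int p * (\<Sum>l<n. of_int (c l) * w l)" unfolding R_eq by blast
  then have "u = (\<Sum>l<n. of_int (p * c l) * w l)" by (simp only: sum_distrib_left of_int_mult mult.assoc)
  then show "u \<in> T n" using T_I[of n "\<lambda>l. p * c l"] by simp
qed

lemma T_n_mult:
  assumes "u \<in> R" "v \<in> T n"
  shows "u * v \<in> T n"
proof -
  obtain v' where "v' \<in> R" "v = of_int p * v'" using assms(2) by (auto simp: T_n_iff)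
  moreover have "u * (of_int p * v') = of_int p * (u * v')" by simp
  ultimately show ?thesis
    using subring_closed(3)[OF is_subring_R assms(1)] unfolding T_n_iff by blast
qed

lemma T_n_I:
  assumes "v \<in> R" "p dvd k"
  shows "of_int k * v \<in> T n"
proof -
  obtain m where "k = p * m" using assms(2) by auto
  then have "of_int k * v = of_int p * (of_int m * v)" by (simp only: of_int_mult mult.assoc)
  moreover have "of_int m * v \<in> R"
    by (intro subring_closed(3) is_subring_R subring_of_int assms(1))
  ultimately show ?thesis unfolding T_n_iff by blast
qed

text \<open>This is \<open>w 1\<close> without its integer term, which is divisible by
  \<open>q\<close>; hence \<open>y \<equiv> w 1\<close> modulo \<open>p R\<close>, and the powers of
  \<open>y\<close> are easier to follow.\<close>

definition y :: 'a where
  "y = of_int (a0 * q) * \<alpha>"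

text \<open>Agrees with \<open>w\<close> for \<open>0 < i < n\<close>, but has
  \<open>z 0 = a0\<close> and \<open>z n = 0\<close>, so that one recursion covers all
  indices.\<close>

definition z :: "nat \<Rightarrow> 'a" where
  "z i = of_int (q ^ i) * int_eval (poly_shift (n - i) f) \<alpha>"

lemma z_eq_w: "0 < i \<Longrightarrow> i < n \<Longrightarrow> z i = w i"
  by (simp add: z_def w_def \<omega>_def omega_poly_def)

lemma z_n: "z n = 0"
  by (simp add: z_def root_f)

lemma z_in_R:
  assumes "0 < i" "i \<le> n"
  shows "z i \<in> R"
proof (cases "i = n")
  case True
  then show ?thesis using subring_closed(1)[OF is_subring_R] by (simp add: z_n)
next
  case False
  then show ?thesis using w_in_T[of i 0] T_subset_R z_eq_w[of i] assms by auto
qed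

lemma z_Suc:
  assumes "i < n"
  shows "z (Suc i) = of_int q * \<alpha> * z i + of_int (q ^ Suc i * coeff f (n - Suc i))"
proof -
  have "poly_shift (n - Suc i) f = pCons (coeff f (n - Suc i)) (poly_shift (n - i) f)"
  proof (rule poly_eqI)
    fix l
    show "coeff (poly_shift (n - Suc i) f) l = coeff (pCons (coeff f (n - Suc i)) (poly_shift (n - i) f)) l"
      using assms by (cases l) (simp_all add: coeff_poly_shift Suc_diff_Suc)
  qed
  then show ?thesis by (simp add: z_def algebra_simps)
qed

text \<open>After multiplying the recursion \<open>z_Suc\<close> by \<open>a0\<close>, its integer
  term contains \<open>q ^ Suc i\<close> and is therefore divisible by \<open>p\<close>.\<close>

lemma y_mult_z:
  assumes "i < n"
  shows "y * z i - of_int a0 * z (Suc i) \<in> T n"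
proof -
  define e where "e = q ^ Suc i * coeff f (n - Suc i)"
  have "y * z i = of_int a0 * (of_int q * \<alpha> * z i)"
    by (simp only: y_def of_int_mult mult.assoc)
  then have "y * z i - of_int a0 * z (Suc i) = of_int (- (a0 * e)) * 1"
    by (simp only: z_Suc[OF assms] flip: e_def) (simp add: distrib_left)
  also have "\<dots> \<in> T n"
    using p_dvd_q by (intro T_n_I subring_closed(2) is_subring_R) (simp add: e_def)
  finally show ?thesis .
qed

lemma y_eq: "y = z 1 - of_int (q * coeff f (n - 1))"
proof -
  have "poly_shift n f = [:a0:]"
    using degree_f by (auto simp: poly_eq_iff coeff_poly_shift coeff_pCons coeff_eq_0 split: nat.split)
  then show ?thesis
    using z_Suc[of 0] n_gt_1 by (simp add: y_def z_def algebra_simps)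
qed

lemma y_in_R: "y \<in> R"
  unfolding y_eq using n_gt_1
  by (intro subring_closed(4) is_subring_R z_in_R subring_of_int) auto

text \<open>The first factor \<open>y\<close> gives \<open>z 1\<close> and each later one
  contributes \<open>a0\<close>, whence the exponent \<open>i - 1\<close>. For \<open>i = n\<close>
  it follows that \<open>y ^ n\<close> lies in \<open>p R\<close>.\<close>

lemma y_power_cong_z:
  assumes "0 < i" "i \<le> n"
  shows "y ^ i - of_int (a0 ^ (i - 1)) * z i \<in> T n"
  using assms
proof (induction i)
  case (Suc i)
  show ?case
  proof (cases "i = 0")
    case True
    then have "y ^ Suc i - of_int (a0 ^ (Suc i - 1)) * z (Suc i) = of_int (- (q * coeff f (n - 1))) * 1"
      by (simp add: y_eq)
    also have "\<dots> \<in> T n"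
      using p_dvd_q by (intro T_n_I subring_closed(2) is_subring_R) auto
    finally show ?thesis .
  next
    case False
    then obtain k where k: "i = Suc k" by (cases i) auto
    have "y ^ Suc i - of_int (a0 ^ (Suc i - 1)) * z (Suc i) =
        y * (y ^ i - of_int (a0 ^ (i - 1)) * z i) + of_int (a0 ^ (i - 1)) * (y * z i - of_int a0 * z (Suc i))"
      by (simp add: k algebra_simps)
    also have "\<dots> \<in> T n"
      using Suc False by (intro T_add T_n_mult T_scale y_mult_z y_in_R) auto
    finally show ?thesis .
  qed
qed simp

lemma y_power_cong_w:
  assumes "i < n"
  shows "y ^ i - of_int (a0 ^ (i - 1)) * w i \<in> T n"
proof (cases "i = 0")
  \<comment> \<open>At \<open>i = 0\<close> the truncated exponent is 0 and
    \<open>w 0 = 1 = y ^ 0\<close>.\<close>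
  case True
  then show ?thesis by (simp add: w_def omega_0 zero_in_T)
next
  case False
  then show ?thesis using y_power_cong_z[of i] z_eq_w[of i] assms by simp
qed

lemma y_power_in_T:
  assumes "i \<le> l" "i \<le> n"
  shows "y ^ l \<in> T i"
proof (cases "l < n")
  case True
  have "(y ^ l - of_int (a0 ^ (l - 1)) * w l) + of_int (a0 ^ (l - 1)) * w l \<in> T i"
    using y_power_cong_w[OF True] T_n_subset
    by (intro T_add T_scale w_in_T True assms) blast
  then show ?thesis by simp
next
  case False
  have "y ^ n \<in> T n" using y_power_cong_z[of n] n_gt_1 by (simp add: z_n)
  then have "y ^ (l - n) * y ^ n \<in> T n"
    by (intro T_n_mult[OF subring_power[OF is_subring_R y_in_R]])
  then show ?thesis using False T_n_subset by (auto simp flip: power_add)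
qed

lemma y_power_mult_poly_in_T:
  assumes "i \<le> l" "i \<le> n"
  shows "y ^ l * int_eval P y \<in> T i"
  using assms(1)
proof (induction P arbitrary: l)
  case (pCons c P)
  have "y ^ l * int_eval (pCons c P) y = of_int c * y ^ l + y ^ Suc l * int_eval P y"
    by (simp add: algebra_simps)
  also have "\<dots> \<in> T i"
    using pCons.prems by (intro T_add T_scale y_power_in_T pCons.IH assms(2)) auto
  finally show ?case .
qed (simp add: zero_in_T)

lemma power_diff_in_T_n:
  assumes "u \<in> R" "v \<in> R" "u - v \<in> T n"
  shows "u ^ i - v ^ i \<in> T n"
proof (induction i)
  case (Suc i)
  have "u ^ Suc i - v ^ Suc i = u * (u ^ i - v ^ i) + v ^ i * (u - v)"
    by (simp add: algebra_simps)
  also have "\<dots> \<in> T n"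
    using Suc assms by (intro T_add T_n_mult subring_power is_subring_R) auto
  finally show ?case .
qed (simp add: zero_in_T)

text \<open>Modulo \<open>p\<close>, the basis element \<open>w i\<close> is \<open>y ^ i\<close> up to a unit and \<open>y ^ n\<close> vanishes, so the
  matrix of the powers of \<open>c 1 * w 1 + c 2 * w 2 + \<dots>\<close> becomes triangular.\<close>

lemma powers_triangular:
  assumes p: "coprime a0 p" and \<gamma>: "\<gamma> = (\<Sum>l\<in>{0<..<n}. of_int (c l) * w l)" and i: "i < n"
  shows "\<gamma> ^ i - of_int (c 1 ^ i * a0 ^ (i - 1)) * w i \<in> T (Suc i)"
proof -
  \<comment> \<open>With \<open>b\<close> an inverse of \<open>a0\<close>, each \<open>w l\<close>
    with \<open>l > 0\<close> is congruent to \<open>b ^ (l - 1) * y ^ l\<close>, so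
    \<open>\<gamma> \<equiv> y * G(y)\<close> modulo \<open>p R\<close>.\<close>
  obtain b where b: "[a0 * b = 1] (mod p)" using cong_solve_coprime_int[OF p] by blast
  define G where "G = (\<Sum>l<n - 1. monom (c (Suc l) * b ^ l) l)"
  have "coeff G 0 = c 1"
    using n_gt_1 by (simp add: G_def coeff_sum)
  then have "coeff (G ^ i) 0 = c 1 ^ i" by (simp add: coeff_0_power)
  then obtain H where H: "G ^ i = pCons (c 1 ^ i) H" by (cases "G ^ i") simp
  have yG_in_R: "y * int_eval G y \<in> R"
    by (intro subring_closed(3) is_subring_R y_in_R subring_int_eval)
  have w_in_R: "w l \<in> R" if "l < n" for l
    using w_in_T[of l 0] that T_subset_R by auto
  have \<gamma>_in_R: "\<gamma> \<in> R"
    unfolding \<gamma> by (intro subring_sum subring_closed(3) is_subring_R subring_of_int w_in_R) auto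
  have "y * int_eval G y = (\<Sum>l<n - 1. of_int (c (Suc l) * b ^ l) * y ^ Suc l)"
    by (simp add: G_def sum_distrib_left algebra_simps)
  also have "\<dots> = (\<Sum>l\<in>{0<..<n}. of_int (c l * b ^ (l - 1)) * y ^ l)"
    using n_gt_1 by (intro sum.reindex_bij_witness[of _ "\<lambda>l. l - 1" Suc]) auto
  finally have "\<gamma> - y * int_eval G y =
      (\<Sum>l\<in>{0<..<n}. of_int (c l) * (of_int (1 - (a0 * b) ^ (l - 1)) * w l -
         of_int (b ^ (l - 1)) * (y ^ l - of_int (a0 ^ (l - 1)) * w l)))"
    unfolding \<gamma> by (simp add: sum_subtractf[symmetric] algebra_simps power_mult_distrib)
  also have "\<dots> \<in> T n"
  proof (intro T_sum T_scale)
    fix l assume "l \<in> {0<..<n}"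
    then have "l < n" by simp
    have "[1 ^ (l - 1) = (a0 * b) ^ (l - 1)] (mod p)" by (intro cong_pow cong_sym[OF b])
    then have "p dvd 1 - (a0 * b) ^ (l - 1)" by (simp add: cong_iff_dvd_diff)
    then show "of_int (1 - (a0 * b) ^ (l - 1)) * w l -
        of_int (b ^ (l - 1)) * (y ^ l - of_int (a0 ^ (l - 1)) * w l) \<in> T n"
      by (intro T_diff T_n_I w_in_R T_scale y_power_cong_w \<open>l < n\<close>)
  qed
  finally have "\<gamma> ^ i - (y * int_eval G y) ^ i \<in> T (Suc i)"
    using power_diff_in_T_n[OF \<gamma>_in_R yG_in_R] T_n_subset by blast
  \<comment> \<open>Modulo \<open>T (Suc i)\<close> only the lowest power \<open>y ^ i\<close>
    survives, with coefficient \<open>c 1 ^ i\<close>.\<close>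
  moreover have "(y * int_eval G y) ^ i = of_int (c 1 ^ i) * y ^ i + y ^ Suc i * int_eval H y"
  proof -
    have "(y * int_eval G y) ^ i = y ^ i * int_eval (G ^ i) y" by (simp add: power_mult_distrib)
    then show ?thesis by (simp add: H algebra_simps)
  qed
  moreover have "y ^ Suc i * int_eval H y \<in> T (Suc i)"
    using i by (intro y_power_mult_poly_in_T) auto
  moreover have "of_int (c 1 ^ i) * (y ^ i - of_int (a0 ^ (i - 1)) * w i) \<in> T (Suc i)"
    using y_power_cong_w[OF i] T_n_subset by (intro T_scale) blast
  ultimately have "(\<gamma> ^ i - (y * int_eval G y) ^ i) + (y ^ Suc i * int_eval H y +
      of_int (c 1 ^ i) * (y ^ i - of_int (a0 ^ (i - 1)) * w i)) \<in> T (Suc i)"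
    by (intro T_add)
  then show ?thesis
    unfolding \<open>(y * int_eval G y) ^ i = _\<close> by (simp add: algebra_simps)
qed

text \<open>The powers of a generator form a basis of \<open>R\<close>, so the square of their
  coordinate determinant is 1; modulo \<open>p\<close> it is the square of the product of the
  triangular diagonal.\<close>

lemma monogenic_imp_power_residue:
  assumes p: "coprime a0 p" and \<beta>: "R = adjoin_Z \<beta>"
  shows "\<exists>x. [x ^ (n * (n - 1)) * a0 ^ ((n - 1) * (n - 2)) = 1] (mod p)"
proof -
  have "\<beta> \<in> R" unfolding \<beta> by (rule adjoin_Z_self)
  then obtain c where c: "\<beta> = (\<Sum>l<n. of_int (c l) * w l)" unfolding R_eq by blast
  \<comment> \<open>Removing the integer part keeps the ring generated by \<open>\<beta>\<close> and
    makes the coordinate matrix of the powers triangular modulo \<open>p\<close>.\<close>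
  define \<gamma> where "\<gamma> = \<beta> - of_int (c 0)"
  have "{..<n} = insert 0 {0<..<n}" using n_gt_1 by auto
  then have \<gamma>: "\<gamma> = (\<Sum>l\<in>{0<..<n}. of_int (c l) * w l)"
    by (simp add: \<gamma>_def c w_def omega_0)
  have \<gamma>_in_R: "\<gamma> \<in> R"
    unfolding \<gamma>_def by (intro subring_closed(4) is_subring_R subring_of_int \<open>\<beta> \<in> R\<close>)
  have w_in_R: "w l \<in> R" if "l < n" for l
    using w_in_T[of l 0] that T_subset_R by auto
  have "\<exists>A. \<gamma> ^ i = (\<Sum>l<n. of_int (A l) * w l) \<and> (\<forall>l<i. p dvd A l) \<and> [A i = c 1 ^ i * a0 ^ (i - 1)] (mod p)"
    if i: "i < n" for i
  proof -
    define e where "e = c 1 ^ i * a0 ^ (i - 1)"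
    obtain d where d: "\<gamma> ^ i - of_int e * w i = (\<Sum>l<n. of_int (d l) * w l)" "\<forall>l<Suc i. p dvd d l"
      using powers_triangular[OF p \<gamma> i] by (auto simp: T_def e_def)
    have "of_int e * w i = (\<Sum>l<n. if l = i then of_int e * w l else 0)" using i by simp
    also have "\<dots> = (\<Sum>l<n. of_int (if l = i then e else 0) * w l)" by (intro sum.cong) auto
    finally have "\<gamma> ^ i = (\<Sum>l<n. of_int (d l + (if l = i then e else 0)) * w l)"
      using d(1) by (simp only: of_int_add distrib_right sum.distrib diff_eq_eq)
    then show ?thesis
      using d(2) by (intro exI[of _ "\<lambda>l. d l + (if l = i then e else 0)"])
        (auto simp: e_def cong_iff_dvd_diff)
  qed
  then obtain A where A: "\<And>i. i < n \<Longrightarrow> \<gamma> ^ i = (\<Sum>l<n. of_int (A i l) * w l)"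
      "\<And>i l. i < n \<Longrightarrow> l < i \<Longrightarrow> p dvd A i l" "\<And>i. i < n \<Longrightarrow> [A i i = c 1 ^ i * a0 ^ (i - 1)] (mod p)"
    by metis
  let ?D = "det (mat n n (\<lambda>(i, l). A i l))"
  have "?D\<^sup>2 = 1"
  proof (rule det_power_basis_square)
    show "c i = 0" if "(\<Sum>i<n. of_int (c i) * w i) = 0" "i < n" for c i
      using w_independent that .
    show "\<gamma> ^ i = (\<Sum>l<n. of_int (A i l) * w l)" if "i < n" for i
      using A(1) that .
    show "0 < n" using n_gt_1 by simp
    show "\<exists>c. \<gamma> * w j = (\<Sum>l<n. of_int (c l) * w l)" if "j < n" for j
      using subring_closed(3)[OF is_subring_R \<gamma>_in_R w_in_R[OF that]] unfolding R_eq by blast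
    show "\<exists>P. w j = int_eval P \<gamma>" if j: "j < n" for j
    proof -
      obtain P where P: "w j = int_eval P \<beta>"
        using w_in_R[OF j] adjoin_Z_subset[of \<beta>] unfolding \<beta> by auto
      have "\<beta> = int_eval [:c 0, 1:] \<gamma>" by (simp add: \<gamma>_def)
      then have "w j = int_eval (pcompose P [:c 0, 1:]) \<gamma>" using P by (simp only: int_eval_pcompose)
      then show ?thesis by blast
    qed
  qed
  have "[?D = (\<Prod>i<n. A i i)] (mod p)"
    by (rule det_cong_triangular) (rule A(2))
  also have "[(\<Prod>i<n. A i i) = (\<Prod>i<n. c 1 ^ i * a0 ^ (i - 1))] (mod p)"
    by (intro cong_prod A(3)) simp
  finally have "[?D\<^sup>2 = (\<Prod>i<n. c 1 ^ i * a0 ^ (i - 1))\<^sup>2] (mod p)"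
    by (rule cong_pow)
  then have "[1 = c 1 ^ (n * (n - 1)) * a0 ^ ((n - 1) * (n - 2))] (mod p)"
    by (simp only: \<open>?D\<^sup>2 = 1\<close> prod_triangular_exponents)
  then show ?thesis by (intro exI) (rule cong_sym)
qed

end

section \<open>Infinitely many orders from the powers of one prime\<close>

theorem theorem1p3:
  fixes K :: "'a::field_char_0 set"
  assumes "number_field K"
    and "field_degree K \<ge> 3"
  shows "infinite {R. rationally_monogenic_order K R \<and> \<not> monogenic_order K R}"
proof -
  define n where "n = field_degree K"
  have n: "n \<ge> 3" using assms(2) by (simp add: n_def)
  obtain p r :: nat and \<alpha> :: 'a and f :: "int poly" where
    p: "prime p" "n dvd p - 1" and gen: "K = Qring \<alpha>" "degree f = n" "content f = 1" "int_eval f \<alpha> = 0"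
    and r: "residue_primroot p r" "[lead_coeff f = int r] (mod int p)"
    by (rule ex_generator_with_primroot_lead_coeff[OF assms(1) n_def n])
  interpret primitive_generator K \<alpha> f n
    by (rule primitive_generator.intro[OF assms(1) gen(1) n_def _ gen(2-4)]) (use n in simp)
  have "coprime (int p) (int r)" using r(1) by (simp add: residue_primroot_def)
  then have cop: "coprime (int p) (lead_coeff f)"
    using r(2) by (metis cong_imp_coprime cong_sym coprime_commute)
  \<comment> \<open>The exponent \<open>Suc k\<close> keeps \<open>p\<close> a divisor of every
    \<open>q k\<close>.\<close>
  define q where "q = (\<lambda>k. int p ^ Suc k)"
  have q: "q k \<noteq> 0" "coprime (q k) (lead_coeff f)" "int p dvd q k" for k
    using cop prime_gt_0_nat[OF p(1)] by (simp_all add: q_def)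
  have "\<not> monogenic_order K (Z_ring (of_int (q k) * \<alpha>))" for k
  proof
    assume "monogenic_order K (Z_ring (of_int (q k) * \<alpha>))"
    then obtain \<beta> where \<beta>: "Z_ring (of_int (q k) * \<alpha>) = adjoin_Z \<beta>"
      by (auto simp: monogenic_order_def)
    interpret scaled_primitive_generator K \<alpha> f n "q k" "int p"
      by unfold_locales (fact q)+
    show False
      using monogenic_imp_power_residue[OF _ \<beta>] cop primroot_power_not_cong[OF p n r]
      by (auto simp: coprime_commute)
  qed
  moreover have "rationally_monogenic_order K (Z_ring (of_int (q k) * \<alpha>))" for k
    by (rule primitive_generator.rationally_monogenic_Z_ring[OF scaled_generator[OF q(1,2)]])
  ultimately have "range (\<lambda>k. Z_ring (of_int (q k) * \<alpha>)) \<subseteq>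
      {R. rationally_monogenic_order K R \<and> \<not> monogenic_order K R}"
    by blast
  moreover have "inj (\<lambda>k. Z_ring (of_int (q k) * \<alpha>))"
  proof (rule injI)
    fix k l assume "Z_ring (of_int (q k) * \<alpha>) = Z_ring (of_int (q l) * \<alpha>)"
    then have "q l dvd q k" "q k dvd q l"
      using Z_ring_scaled_inj q(1,2) by (metis order_refl)+
    then show "k = l"
      using prime_gt_1_nat[OF p(1)] by (simp add: q_def dvd_power_iff_le flip: of_nat_power)
  qed
  ultimately show ?thesis
    using infinite_super range_inj_infinite by blast
qed

end
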